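(* If $\omega$ is an extreme point of the convex set $\mathcal{S}^{\mathbb{O}_{\mathbb{Z}}}(\mathfrak{B}_0)$ of all $\mathbb{O}_{\mathbb{Z}}$-invariant states on $\mathfrak{B}_0$, then there exists a state $\varphi$ on $\mathfrak{A}=\mathrm{CCR}(\mathbb{C},\sigma)$ such that $\omega=\otimes_{\mathbb{Z}}\varphi$.
   Context: $\mathcal{H}$ is an infinite-dimensional separable complex Hilbert space (inner product linear in the first variable) with a fixed orthonormal basis $\{e_k:k\in\mathbb{Z}\}$, and $\sigma(x,y)=\mathrm{Im}\langle x,y\rangle$. $\mathrm{CCR}(\mathcal{H},\sigma)$ is the universal $C^*$-algebra generated by elements $W(x)$, $x\in\mathcal{H}$, with $W(x)^*=W(-x)$ and $W(x)W(y)=e^{i\sigma(x,y)}W(x+y)$. $\mathcal{H}_0$ is the (algebraic) linear span of $\{e_k\}$, and $\mathfrak{B}_0=\mathrm{CCR}(\mathcal{H}_0,\sigma)$ is the $C^*$-subalgebra of $\mathrm{CCR}(\mathcal{H},\sigma)$ generated by $\{W(x):x\in\mathcal{H}_0\}$. $\mathfrak{A}=\mathrm{CCR}(\mathbb{C},\sigma)$ is the analogous algebra for $\mathbb{C}$ with $\sigma(z,w)=\mathrm{Im}\, z\bar w$. For $k\in\mathbb{Z}$, $i_k:\mathfrak{A}\to\mathfrak{B}_0$ is the embedding with $i_k(W(z))=W(ze_k)$; through these embeddings $\mathfrak{B}_0$ is identified with the infinite $C^*$-tensor product $\bigotimes_{\mathbb{Z}}\mathfrak{A}$. For a state $\varphi$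 on $\mathfrak{A}$, $\otimes_{\mathbb{Z}}\varphi$ is the product state on $\mathfrak{B}_0$ determined by $(\otimes_{\mathbb{Z}}\varphi)(i_{k_1}(a_1)\cdots i_{k_n}(a_n))=\varphi(a_1)\cdots\varphi(a_n)$ for distinct $k_1,\dots,k_n\in\mathbb{Z}$ and $a_1,\dots,a_n\in\mathfrak{A}$. $\mathbb{U}_{\mathbb{Z}}$ is the group of unitaries $U$ on $\mathcal{H}$ for which there is $N>0$ with $Ue_i=e_i$ for all $|i|>N$; $\mathbb{O}_{\mathbb{Z}}$ is the subgroup of those $O\in\mathbb{U}_{\mathbb{Z}}$ with $\langle Oe_i,e_j\rangle\in\mathbb{R}$ for all $i,j$. These groups act on $\mathfrak{B}_0$ by the automorphisms $\rho_U$ determined by $\rho_U(W(x))=W(Ux)$. A state $\omega$ is $\mathbb{O}_{\mathbb{Z}}$-invariant (rotatable) if $\omega\circ\rho_O=\omega$ for all $O\in\mathbb{O}_{\mathbb{Z}}$. *)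

theory Defs
  imports "HOL-Analysis.Analysis" "HOL-Library.Poly_Mapping"
begin

section \<open>Complex vector spaces, Hilbert spaces and C*-algebras\<close>

class scaleC =
  fixes scaleC :: "complex \<Rightarrow> 'a \<Rightarrow> 'a" (infixr "*\<^sub>C" 75)

class complex_vector = real_vector + scaleC +
  assumes scaleC_add_right: "c *\<^sub>C (x + y) = c *\<^sub>C x + c *\<^sub>C y"
    and scaleC_add_left: "(c + d) *\<^sub>C x = c *\<^sub>C x + d *\<^sub>C x"
    and scaleC_scaleC [simp]: "c *\<^sub>C d *\<^sub>C x = (c * d) *\<^sub>C x"
    and scaleC_one [simp]: "1 *\<^sub>C x = x"
    and scaleR_scaleC: "r *\<^sub>R x = complex_of_real r *\<^sub>C x"

interpretation complex_vector: vector_space "scaleC :: complex \<Rightarrow> 'a \<Rightarrow> 'a::complex_vector"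
  by unfold_locales (auto simp: scaleC_add_right scaleC_add_left)

text \<open>The inner product is linear in its \<^emph>\<open>first\<close> argument.\<close>

class complex_inner = complex_vector + real_normed_vector +
  fixes cinner :: "'a \<Rightarrow> 'a \<Rightarrow> complex"
  assumes cinner_add_left: "cinner (x + y) z = cinner x z + cinner y z"
    and cinner_scaleC_left: "cinner (c *\<^sub>C x) y = c * cinner x y"
    and cinner_commute: "cinner y x = cnj (cinner x y)"
    and cinner_self: "cinner x x = complex_of_real ((norm x)\<^sup>2)"

class complex_hilbert = complex_inner + banach

instantiation complex :: complex_hilbert
begin
definition scaleC_complex :: "complex \<Rightarrow> complex \<Rightarrow> complex" where "scaleC_complex = (*)"
definition cinner_complex :: "complex \<Rightarrow> complex \<Rightarrow> complex" where "cinner_complex z w = z * cnj w"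
instance
proof
  fix x :: complex
  show "cinner x x = complex_of_real ((norm x)\<^sup>2)"
    unfolding cinner_complex_def complex_norm_square ..
qed (simp_all add: scaleC_complex_def cinner_complex_def ring_distribs scaleR_conv_of_real)
end

class star_algebra = complex_vector + real_algebra_1 +
  fixes star :: "'a \<Rightarrow> 'a"
  assumes mult_scaleC_left [simp]: "(c *\<^sub>C x) * y = c *\<^sub>C (x * y)"
    and mult_scaleC_right [simp]: "x * (c *\<^sub>C y) = c *\<^sub>C (x * y)"
    and star_add: "star (x + y) = star x + star y"
    and star_scaleC: "star (c *\<^sub>C x) = cnj c *\<^sub>C star x"
    and star_mult: "star (x * y) = star y * star x"
    and star_star [simp]: "star (star x) = x"

class pre_cstar_algebra = star_algebra + real_normed_algebra_1 +
  assumes cstar_identity: "norm (star x * x) = (norm x)\<^sup>2"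

class cstar_algebra = pre_cstar_algebra + banach

lemma scaleC_zero_left [simp]: "0 *\<^sub>C (x::'a::complex_vector) = 0"
  by (rule complex_vector.scale_zero_left)

lemma scaleC_zero_right [simp]: "c *\<^sub>C (0::'a::complex_vector) = 0"
  by (rule complex_vector.scale_zero_right)

lemma star_zero [simp]: "star (0::'a::star_algebra) = 0"
  using star_add[of "0::'a" 0] by simp

lemma star_minus: "star (- x) = - star (x::'a::star_algebra)"
  using star_add[of x "-x"] by (simp add: eq_neg_iff_add_eq_0 add.commute)

lemma star_diff: "star (x - y) = star x - star (y::'a::star_algebra)"
  using star_add[of x "-y"] by (simp add: star_minus)

lemma star_one [simp]: "star (1::'a::star_algebra) = 1"
  using star_mult[of "star (1::'a)" 1] by simp

lemma star_sum: "star (sum f A) = (\<Sum>x\<in>A. star (f x :: 'a::star_algebra))"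
  by (induction A rule: infinite_finite_induct) (auto simp: star_add)

lemma norm_star [simp]: "norm (star x) = norm (x::'a::pre_cstar_algebra)"
proof -
  have le: "norm y \<le> norm (star y)" for y :: 'a
  proof (cases "y = 0")
    case False
    have "norm y * norm y \<le> norm (star y) * norm y"
      using cstar_identity[of y] norm_mult_ineq[of "star y" y] by (simp add: power2_eq_square)
    then show ?thesis using False by simp
  qed simp
  from le[of x] le[of "star x"] show ?thesis by simp
qed

lemma norm_scaleC [simp]: "norm (c *\<^sub>C x) = cmod c * norm (x::'a::pre_cstar_algebra)"
proof -
  have "star (c *\<^sub>C x) * (c *\<^sub>C x) = (cmod c)\<^sup>2 *\<^sub>R (star x * x)"
    by (simp add: star_scaleC scaleR_scaleC complex_norm_square mult.commute del: of_real_power)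
  then have "(norm (c *\<^sub>C x))\<^sup>2 = (cmod c * norm x)\<^sup>2"
    by (metis abs_of_nonneg cstar_identity norm_scaleR power_mult_distrib zero_le_power2)
  then show ?thesis by (simp add: power2_eq_iff_nonneg)
qed

lemma cinner_zero_left [simp]: "cinner 0 (x::'a::complex_inner) = 0"
  using cinner_add_left[of 0 0 x] by simp

lemma cinner_zero_right [simp]: "cinner (x::'a::complex_inner) 0 = 0"
  by (metis cinner_commute cinner_zero_left complex_cnj_zero)

lemma cinner_add_right: "cinner (x::'a::complex_inner) (y + z) = cinner x y + cinner x z"
  by (metis cinner_add_left cinner_commute complex_cnj_add)

lemma cinner_scaleC_right: "cinner (x::'a::complex_inner) (c *\<^sub>C y) = cnj c * cinner x y"
  by (metis cinner_commute cinner_scaleC_left complex_cnj_mult)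

lemma cinner_minus_left [simp]: "cinner (- x) (y::'a::complex_inner) = - cinner x y"
  using cinner_add_left[of x "-x" y] by (simp add: eq_neg_iff_add_eq_0 add.commute)

lemma cinner_minus_right [simp]: "cinner (x::'a::complex_inner) (- y) = - cinner x y"
  by (metis cinner_commute cinner_minus_left complex_cnj_minus)


section \<open>The symplectic form and the Weyl relations\<close>

definition symplectic :: "'h::complex_inner \<Rightarrow> 'h \<Rightarrow> real" where
  "symplectic x y = Im (cinner x y)"

definition weyl_relations :: "('h::complex_inner \<Rightarrow> 'a::star_algebra) \<Rightarrow> bool" where
  "weyl_relations V \<longleftrightarrow> (\<forall>x. star (V x) = V (- x)) \<and>
     (\<forall>x y. V x * V y = exp (\<i> * complex_of_real (symplectic x y)) *\<^sub>C V (x + y))"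

definition phase :: "'h::complex_inner \<Rightarrow> 'h \<Rightarrow> complex" where
  "phase x y = exp (\<i> * complex_of_real (symplectic x y))"

lemma phase_add_left: "phase (x + y) z = phase x z * phase y z"
  and phase_add_right: "phase x (y + z) = phase x y * phase x z"
  by (simp_all add: phase_def symplectic_def cinner_add_left cinner_add_right exp_add ring_distribs)

lemma phase_zero [simp]: "phase 0 x = 1" "phase x 0 = 1"
  by (simp_all add: phase_def symplectic_def)

lemma phase_minus_self [simp]: "phase (- x) x = 1"
  by (simp add: phase_def symplectic_def cinner_self)

lemma cnj_phase: "cnj (phase x y) = phase y x"
  by (simp add: phase_def symplectic_def exp_cnj cinner_commute[of x y])

lemma phase_minus_minus: "phase (- x) (- y) = phase x y"
  by (simp add: phase_def symplectic_def)


section \<open>The *-algebra generated by the Weyl elements\<close>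

text \<open>
  The *-algebra with generators \<open>W x\<close> and the Weyl relations has the \<open>W x\<close> as a vector space
  basis, so its elements are finitely supported functions on \<open>'h\<close>.  A copy of the type
  \<^typ>\<open>'h \<Rightarrow>\<^sub>0 complex\<close> is used because that type already carries the untwisted convolution product.
\<close>

typedef (overloaded) 'h weyl = "UNIV :: ('h \<Rightarrow>\<^sub>0 complex) set"
  morphisms wcoeffs Weyl ..

setup_lifting type_definition_weyl

instantiation weyl :: (type) complex_vector
begin
lift_definition zero_weyl :: "'a weyl" is 0 .
lift_definition plus_weyl :: "'a weyl \<Rightarrow> 'a weyl \<Rightarrow> 'a weyl" is "(+)" .
lift_definition minus_weyl :: "'a weyl \<Rightarrow> 'a weyl \<Rightarrow> 'a weyl" is "(-)" .
lift_definition uminus_weyl :: "'a weyl \<Rightarrow> 'a weyl" is uminus .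
lift_definition scaleC_weyl :: "complex \<Rightarrow> 'a weyl \<Rightarrow> 'a weyl" is "\<lambda>c. Poly_Mapping.map ((*) c)" .
definition scaleR_weyl :: "real \<Rightarrow> 'a weyl \<Rightarrow> 'a weyl" where
  "scaleR_weyl r f = complex_of_real r *\<^sub>C f"
instance
proof
  have lm: "Poly_Mapping.lookup (Poly_Mapping.map ((*) c) f) x = c * Poly_Mapping.lookup f x" for c :: complex and f and x :: 'a
    by (simp add: Poly_Mapping.map.rep_eq when_def)
  fix c d :: complex and x y z :: "'a weyl" and r s :: real
  show "x + y + z = x + (y + z)" by transfer (simp add: add.assoc)
  show "x + y = y + x" by transfer (simp add: add.commute)
  show "0 + x = x" by transfer simp
  show "- x + x = 0" by transfer simp
  show "x - y = x + - y" by transfer simp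
  show a: "c *\<^sub>C (x + y) = c *\<^sub>C x + c *\<^sub>C y" for c and x y :: "'a weyl"
    by transfer (auto intro!: poly_mapping_eqI simp: lm lookup_add ring_distribs)
  show b: "(c + d) *\<^sub>C x = c *\<^sub>C x + d *\<^sub>C x" for c d and x :: "'a weyl"
    by transfer (auto intro!: poly_mapping_eqI simp: lm lookup_add ring_distribs)
  show e: "c *\<^sub>C d *\<^sub>C x = (c * d) *\<^sub>C x" for c d and x :: "'a weyl"
    by transfer (auto intro!: poly_mapping_eqI simp: lm ac_simps)
  show f: "1 *\<^sub>C x = x" for x :: "'a weyl"
    by transfer (auto intro!: poly_mapping_eqI simp: lm)
  show "r *\<^sub>R x = complex_of_real r *\<^sub>C x" by (simp add: scaleR_weyl_def)
  show "r *\<^sub>R (x + y) = r *\<^sub>R x + r *\<^sub>R y" "(r + s) *\<^sub>R x = r *\<^sub>R x + s *\<^sub>R x"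
    "r *\<^sub>R s *\<^sub>R x = (r * s) *\<^sub>R x" "1 *\<^sub>R x = x"
    by (simp_all add: scaleR_weyl_def a b e f)
qed
end

lift_definition wcoeff :: "'h weyl \<Rightarrow> 'h \<Rightarrow> complex" is Poly_Mapping.lookup .

lift_definition wsupp :: "'h weyl \<Rightarrow> 'h set" is Poly_Mapping.keys .

lift_definition wbasis :: "'h \<Rightarrow> 'h weyl" is "\<lambda>x. Poly_Mapping.single x 1" .

lemma wcoeff_simps [simp]:
  "wcoeff 0 x = 0" "wcoeff (f + g) x = wcoeff f x + wcoeff g x"
  "wcoeff (f - g) x = wcoeff f x - wcoeff g x" "wcoeff (- f) x = - wcoeff f x"
  "wcoeff (c *\<^sub>C f) x = c * wcoeff f x"
  by (transfer; simp add: lookup_add lookup_minus Poly_Mapping.map.rep_eq when_def)+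

lemma wcoeff_basis: "wcoeff (wbasis x) y = (if x = y then 1 else 0)"
  by transfer (simp add: lookup_single when_def)

lemma wcoeff_sum: "wcoeff (sum f A) x = (\<Sum>a\<in>A. wcoeff (f a) x)"
  by (induction A rule: infinite_finite_induct) auto

lemma finite_wsupp [simp]: "finite (wsupp f)"
  by transfer simp

lemma wsupp_iff: "x \<in> wsupp f \<longleftrightarrow> wcoeff f x \<noteq> 0"
  by transfer (simp add: in_keys_iff)

lemma weyl_eqI: "(\<And>x. wcoeff f x = wcoeff g x) \<Longrightarrow> f = g"
  by transfer (auto intro: poly_mapping_eqI)

lemma weyl_expand: "f = (\<Sum>x\<in>wsupp f. wcoeff f x *\<^sub>C wbasis x)"
  by (rule weyl_eqI) (auto simp: wcoeff_sum wcoeff_basis wsupp_iff if_distrib sum.delta cong: if_cong)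

lemma weyl_induct [case_names zero add]:
  assumes "P 0" and "\<And>c x f. P f \<Longrightarrow> P (c *\<^sub>C wbasis x + f)"
  shows "P f"
proof -
  have "P (\<Sum>x\<in>A. wcoeff f x *\<^sub>C wbasis x)" if "finite A" for A
    using that by induction (auto intro: assms)
  then show ?thesis using weyl_expand[of f] by (metis finite_wsupp)
qed

definition wext :: "('h \<Rightarrow> 'a::complex_vector) \<Rightarrow> 'h weyl \<Rightarrow> 'a" where
  "wext V f = (\<Sum>x\<in>wsupp f. wcoeff f x *\<^sub>C V x)"

lemma wext_superset:
  assumes "finite A" "wsupp f \<subseteq> A" shows "wext V f = (\<Sum>x\<in>A. wcoeff f x *\<^sub>C V x)"
  unfolding wext_def using assms by (intro sum.mono_neutral_left) (auto simp: wsupp_iff)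

lemma wext_add [simp]: "wext V (f + g) = wext V f + wext V g"
proof -
  let ?A = "wsupp f \<union> wsupp g"
  have "wsupp (f + g) \<subseteq> ?A" by (auto simp: wsupp_iff)
  then show ?thesis
    by (simp add: wext_superset[of ?A] scaleC_add_left sum.distrib)
qed

lemma wext_scaleC [simp]: "wext V (c *\<^sub>C f) = c *\<^sub>C wext V f"
proof -
  have "wsupp (c *\<^sub>C f) \<subseteq> wsupp f" by (auto simp: wsupp_iff)
  then show ?thesis
    by (simp add: wext_superset[of "wsupp f"] complex_vector.scale_sum_right)
qed

lemma wext_zero [simp]: "wext V 0 = 0"
  using wext_scaleC[of V 0 0] by simp

lemma wext_basis [simp]: "wext V (wbasis x) = V x"
  by (subst wext_superset[of "{x}"]) (auto simp: wsupp_iff wcoeff_basis split: if_splits)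

lemma wext_zero_fun [simp]: "wext (\<lambda>x. 0) f = 0"
  by (simp add: wext_def)

lemma wext_add_fun: "wext (\<lambda>x. U x + V x) f = wext U f + wext V f"
  by (simp add: wext_def scaleC_add_right sum.distrib)

lemma wext_scaleC_fun: "wext (\<lambda>x. c *\<^sub>C V x) f = c *\<^sub>C wext V f"
  by (simp add: wext_def complex_vector.scale_sum_right mult.commute)

instantiation weyl :: (complex_inner) star_algebra
begin

definition one_weyl :: "'a weyl" where "one_weyl = wbasis 0"

definition times_weyl :: "'a weyl \<Rightarrow> 'a weyl \<Rightarrow> 'a weyl" where
  "times_weyl f g = wext (\<lambda>x. wext (\<lambda>y. phase x y *\<^sub>C wbasis (x + y)) g) f"

definition star_weyl :: "'a weyl \<Rightarrow> 'a weyl" where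
  "star_weyl f = (\<Sum>x\<in>wsupp f. cnj (wcoeff f x) *\<^sub>C wbasis (- x))"

instance
proof
  fix c :: complex and f g h :: "'a weyl" and r :: real
  have bas: "wbasis x * wbasis y = phase x y *\<^sub>C wbasis (x + y)" for x y :: 'a
    by (simp add: times_weyl_def)
  show dl: "(f + g) * h = f * h + g * h" for f g h :: "'a weyl"
    by (simp add: times_weyl_def)
  show dr: "f * (g + h) = f * g + f * h" for f g h :: "'a weyl"
    by (simp add: times_weyl_def wext_add_fun)
  show sl: "(c *\<^sub>C f) * g = c *\<^sub>C (f * g)" for c and f g :: "'a weyl"
    by (simp add: times_weyl_def)
  show sr: "f * (c *\<^sub>C g) = c *\<^sub>C (f * g)" for c and f g :: "'a weyl"
    by (simp add: times_weyl_def wext_scaleC_fun)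
  have zl: "0 * f = 0" and zr: "f * 0 = 0" for f :: "'a weyl"
    by (simp_all add: times_weyl_def)
  have as3: "wbasis x * wbasis y * wbasis z = wbasis x * (wbasis y * wbasis z)" for x y z :: 'a
    by (simp add: bas sl sr phase_add_left phase_add_right add.assoc ac_simps)
  have as2: "wbasis x * wbasis y * h = wbasis x * (wbasis y * h)" for x y :: 'a and h
    by (induction h rule: weyl_induct) (simp_all add: zr dr sr as3)
  have as1: "wbasis x * g * h = wbasis x * (g * h)" for x :: 'a and g h
    by (induction g rule: weyl_induct) (simp_all add: zr zl dr dl sl sr as2)
  show "f * g * h = f * (g * h)"
    by (induction f rule: weyl_induct) (simp_all add: zl dl sl as1)
  show "1 * f = f"
    by (induction f rule: weyl_induct) (simp_all add: one_weyl_def zr dr sr bas)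
  show "f * 1 = f"
    by (induction f rule: weyl_induct) (simp_all add: one_weyl_def zl dl sl bas)
  show "(0::'a weyl) \<noteq> 1"
  proof
    assume "(0::'a weyl) = 1"
    then have "wcoeff (0::'a weyl) 0 = wcoeff 1 0" by simp
    then show False by (simp add: one_weyl_def wcoeff_basis)
  qed
  show "(r *\<^sub>R f) * g = r *\<^sub>R (f * g)" "f * (r *\<^sub>R g) = r *\<^sub>R (f * g)"
    by (simp_all add: scaleR_scaleC sl sr)
  have ss: "star f = (\<Sum>x\<in>A. cnj (wcoeff f x) *\<^sub>C wbasis (- x))"
    if "finite A" "wsupp f \<subseteq> A" for A and f :: "'a weyl"
    unfolding star_weyl_def using that by (intro sum.mono_neutral_left) (auto simp: wsupp_iff)
  show sa: "star (f + g) = star f + star g" for f g :: "'a weyl"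
  proof -
    let ?A = "wsupp f \<union> wsupp g"
    have "wsupp (f + g) \<subseteq> ?A" by (auto simp: wsupp_iff)
    then show ?thesis
      by (simp add: ss[of ?A] scaleC_add_left sum.distrib)
  qed
  show sc: "star (c *\<^sub>C f) = cnj c *\<^sub>C star f" for c and f :: "'a weyl"
  proof -
    have "wsupp (c *\<^sub>C f) \<subseteq> wsupp f" by (auto simp: wsupp_iff)
    then show ?thesis
      by (simp add: ss[of "wsupp f"] complex_vector.scale_sum_right)
  qed
  have s0: "star (0::'a weyl) = 0" using sc[of 0 0] by simp
  have sb: "star (wbasis x) = wbasis (- x)" for x :: 'a
    by (subst ss[of "{x}"]) (auto simp: wsupp_iff wcoeff_basis split: if_splits)
  show "star (star f) = f"
    by (induction f rule: weyl_induct) (simp_all add: s0 sa sc sb)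
  have m2: "star (wbasis x * wbasis y) = star (wbasis y) * star (wbasis x)" for x y :: 'a
    by (simp add: bas sb sc cnj_phase phase_minus_minus add.commute)
  have m1: "star (wbasis x * g) = star g * star (wbasis x)" for x :: 'a and g
    by (induction g rule: weyl_induct) (simp_all add: zl zr dl dr sl sr s0 sa sc m2)
  show "star (f * g) = star g * star f"
    by (induction f rule: weyl_induct) (simp_all add: zl zr dl dr sl sr s0 sa sc m1)
qed

end

lemma wbasis_mult: "wbasis x * wbasis y = phase x y *\<^sub>C wbasis (x + y)"
  by (simp add: times_weyl_def)

lemma star_wbasis [simp]: "star (wbasis x) = wbasis (- x)"
proof -
  have "wsupp (wbasis x) = {x}" by (auto simp: wsupp_iff wcoeff_basis split: if_splits)
  then show ?thesis by (simp add: star_weyl_def wcoeff_basis)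
qed

lemma weyl_relations_wbasis: "weyl_relations wbasis"
  by (simp add: weyl_relations_def wbasis_mult phase_def)


section \<open>The universal C*-norm\<close>

definition cstar_seminorm :: "('a::star_algebra \<Rightarrow> real) \<Rightarrow> bool" where
  "cstar_seminorm p \<longleftrightarrow>
     (\<forall>a b. p (a + b) \<le> p a + p b) \<and> (\<forall>c a. p (c *\<^sub>C a) = cmod c * p a) \<and>
     (\<forall>a b. p (a * b) \<le> p a * p b) \<and> (\<forall>a. p (star a * a) = (p a)\<^sup>2)"

lemma cstar_seminormD:
  assumes "cstar_seminorm p"
  shows "p (a + b) \<le> p a + p b" "p (c *\<^sub>C a) = cmod c * p a" "p (a * b) \<le> p a * p b"
    "p (star a * a) = (p a)\<^sup>2"
  using assms by (auto simp: cstar_seminorm_def)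

lemma cstar_seminorm_nonneg:
  assumes "cstar_seminorm p" shows "0 \<le> p a"
proof -
  have "p 0 = 0" using cstar_seminormD(2)[OF assms, of 0 0] by simp
  moreover have "p (-a) = p a"
    using cstar_seminormD(2)[OF assms, of "-1" a] by (simp add: complex_vector.scale_minus_left)
  ultimately show ?thesis using cstar_seminormD(1)[OF assms, of a "-a"] by simp
qed

lemma cstar_seminorm_wbasis_le:
  assumes "cstar_seminorm p" shows "p (wbasis x) \<le> 1"
proof -
  have "p 1 = (p 1)\<^sup>2" using cstar_seminormD(4)[OF assms, of 1] by simp
  then have 1: "p 1 = 0 \<or> p 1 = 1" by (simp add: power2_eq_square)
  have "(p (wbasis x))\<^sup>2 = p 1"
    using cstar_seminormD(4)[OF assms, of "wbasis x"] by (simp add: wbasis_mult one_weyl_def)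
  with 1 have "(p (wbasis x))\<^sup>2 \<le> 1\<^sup>2" by auto
  then show ?thesis by (rule power2_le_imp_le) simp
qed

lemma cstar_seminorm_weyl_le:
  assumes "cstar_seminorm p" shows "p f \<le> (\<Sum>x\<in>wsupp f. cmod (wcoeff f x))"
proof -
  have "p (\<Sum>x\<in>A. wcoeff f x *\<^sub>C wbasis x) \<le> (\<Sum>x\<in>A. cmod (wcoeff f x))" if "finite A" for A
    using that
  proof induction
    case empty
    show ?case using cstar_seminormD(2)[OF assms, of 0 0] by simp
  next
    case (insert x A)
    have "p (wcoeff f x *\<^sub>C wbasis x) \<le> cmod (wcoeff f x)"
      using cstar_seminorm_wbasis_le[OF assms, of x]
      by (simp add: cstar_seminormD(2)[OF assms] mult_left_le)
    with insert cstar_seminormD(1)[OF assms, of "wcoeff f x *\<^sub>C wbasis x"] show ?case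
      by (smt (verit, ccfv_SIG) sum.insert)
  qed
  then show ?thesis using weyl_expand[of f] by (metis finite_wsupp)
qed

definition wnorm :: "'h::complex_inner weyl \<Rightarrow> real" where
  "wnorm f = Sup {p f | p. cstar_seminorm p}"

lemma wnorm_bdd: "bdd_above {p f | p. cstar_seminorm p}" for f :: "'h::complex_inner weyl"
  by (rule bdd_aboveI[of _ "\<Sum>x\<in>wsupp f. cmod (wcoeff f x)"]) (auto intro: cstar_seminorm_weyl_le)

lemma cstar_seminorm_zero: "cstar_seminorm (\<lambda>_. 0)"
  by (simp add: cstar_seminorm_def)

lemma cstar_seminorm_le_wnorm: "cstar_seminorm p \<Longrightarrow> p f \<le> wnorm f"
  unfolding wnorm_def by (rule cSup_upper[OF _ wnorm_bdd]) auto

lemma wnorm_leI: "(\<And>p. cstar_seminorm p \<Longrightarrow> p f \<le> B) \<Longrightarrow> wnorm f \<le> B"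
  unfolding wnorm_def using cstar_seminorm_zero by (intro cSup_least) auto

lemma wnorm_nonneg: "0 \<le> wnorm f"
  using cstar_seminorm_le_wnorm[OF cstar_seminorm_zero] .

lemma cstar_seminorm_wnorm: "cstar_seminorm (wnorm :: 'h::complex_inner weyl \<Rightarrow> real)"
  unfolding cstar_seminorm_def
proof (intro conjI allI)
  fix f g :: "'h weyl" and c :: complex
  show "wnorm (f + g) \<le> wnorm f + wnorm g"
  proof (rule wnorm_leI)
    fix p :: "'h weyl \<Rightarrow> real" assume p: "cstar_seminorm p"
    show "p (f + g) \<le> wnorm f + wnorm g"
      using cstar_seminormD(1)[OF p, of f g] cstar_seminorm_le_wnorm[OF p] by (meson add_mono order_trans)
  qed
  have le: "wnorm (c *\<^sub>C f) \<le> cmod c * wnorm f" for c f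
    by (rule wnorm_leI)
      (auto simp: cstar_seminormD(2) intro!: mult_left_mono cstar_seminorm_le_wnorm)
  show "wnorm (c *\<^sub>C f) = cmod c * wnorm f"
  proof (cases "c = 0")
    case True
    then show ?thesis using le[of 0 f] wnorm_nonneg[of "0 *\<^sub>C f"] by simp
  next
    case False
    have "wnorm f \<le> cmod (inverse c) * wnorm (c *\<^sub>C f)" using le[of "inverse c" "c *\<^sub>C f"] False by simp
    then have "cmod c * wnorm f \<le> wnorm (c *\<^sub>C f)"
      using False by (simp add: norm_divide norm_inverse field_simps)
    then show ?thesis using le[of c f] by simp
  qed
  show "wnorm (f * g) \<le> wnorm f * wnorm g"
  proof (rule wnorm_leI)
    fix p :: "'h weyl \<Rightarrow> real" assume p: "cstar_seminorm p"
    have "p f * p g \<le> wnorm f * wnorm g"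
      by (intro mult_mono cstar_seminorm_le_wnorm p wnorm_nonneg cstar_seminorm_nonneg)
    then show "p (f * g) \<le> wnorm f * wnorm g" using cstar_seminormD(3)[OF p, of f g] by simp
  qed
  show "wnorm (star f * f) = (wnorm f)\<^sup>2"
  proof (rule antisym)
    show "wnorm (star f * f) \<le> (wnorm f)\<^sup>2"
      by (rule wnorm_leI)
        (auto simp: cstar_seminormD(4) intro!: power_mono cstar_seminorm_le_wnorm cstar_seminorm_nonneg)
    have "wnorm f \<le> sqrt (wnorm (star f * f))"
    proof (rule wnorm_leI)
      fix p :: "'h weyl \<Rightarrow> real" assume p: "cstar_seminorm p"
      show "p f \<le> sqrt (wnorm (star f * f))"
        using cstar_seminorm_le_wnorm[OF p, of "star f * f"]
        by (simp add: cstar_seminormD(4)[OF p] real_le_rsqrt)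
    qed
    then show "(wnorm f)\<^sup>2 \<le> wnorm (star f * f)"
      by (metis real_sqrt_pow2 power_mono wnorm_nonneg)
  qed
qed

text \<open>That \<^term>\<open>wnorm\<close> is a norm follows from the (twisted) regular representation on \<open>\<ell>\<^sup>2\<close>.\<close>

definition l2norm :: "'h weyl \<Rightarrow> real" where
  "l2norm f = L2_set (\<lambda>x. cmod (wcoeff f x)) (wsupp f)"

lemma l2norm_superset:
  assumes "finite A" "wsupp f \<subseteq> A" shows "l2norm f = L2_set (\<lambda>x. cmod (wcoeff f x)) A"
  unfolding l2norm_def L2_set_def using assms
  by (intro arg_cong[of _ _ sqrt] sum.mono_neutral_left) (auto simp: wsupp_iff)

lemma l2norm_nonneg [simp]: "0 \<le> l2norm f"
  by (simp add: l2norm_def)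

lemma l2norm_add: "l2norm (f + g) \<le> l2norm f + l2norm g"
proof -
  let ?A = "wsupp f \<union> wsupp g"
  have s: "wsupp (f + g) \<subseteq> ?A" by (auto simp: wsupp_iff)
  have "l2norm (f + g) \<le> L2_set (\<lambda>x. cmod (wcoeff f x) + cmod (wcoeff g x)) ?A"
    by (subst l2norm_superset[of ?A]) (auto simp: s norm_triangle_ineq intro!: L2_set_mono)
  also have "\<dots> \<le> l2norm f + l2norm g"
    by (subst (1 2) l2norm_superset[of ?A]) (auto intro: L2_set_triangle_ineq)
  finally show ?thesis .
qed

lemma l2norm_scaleC: "l2norm (c *\<^sub>C f) = cmod c * l2norm f"
proof -
  have "wsupp (c *\<^sub>C f) \<subseteq> wsupp f" by (auto simp: wsupp_iff)
  then show ?thesis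
    by (simp add: l2norm_superset[of "wsupp f"] norm_mult L2_set_right_distrib)
qed

lemma l2norm_zero [simp]: "l2norm 0 = 0"
  using l2norm_scaleC[of 0 0] by simp

lemma l2norm_eq_0: "l2norm f = 0 \<Longrightarrow> f = 0"
  by (rule weyl_eqI) (auto simp: l2norm_def L2_set_eq_0_iff wsupp_iff)

lemma wcoeff_star_mult_0:
  "wcoeff (star h * g) 0 = (\<Sum>x\<in>wsupp g. wcoeff g x * cnj (wcoeff h x))"
proof -
  have b: "wcoeff (star h * wbasis x) 0 = cnj (wcoeff h x)" for x
    by (induction h rule: weyl_induct)
      (auto simp: star_add star_scaleC ring_distribs wbasis_mult wcoeff_basis)
  have "wcoeff (star h * g) 0 = wcoeff (star h * (\<Sum>x\<in>wsupp g. wcoeff g x *\<^sub>C wbasis x)) 0"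
    using weyl_expand[of g] by simp
  then show ?thesis by (simp add: sum_distrib_left wcoeff_sum b)
qed

lemma wcoeff_star_self: "wcoeff (star g * g) 0 = complex_of_real ((l2norm g)\<^sup>2)"
  by (simp add: wcoeff_star_mult_0 l2norm_def L2_set_def sum_nonneg complex_norm_square
      flip: of_real_power)

lemma wcoeff_star_mult_le: "cmod (wcoeff (star h * g) 0) \<le> l2norm g * l2norm h"
proof -
  let ?A = "wsupp g \<union> wsupp h"
  have "cmod (wcoeff (star h * g) 0) \<le> (\<Sum>x\<in>wsupp g. \<bar>cmod (wcoeff g x)\<bar> * \<bar>cmod (wcoeff h x)\<bar>)"
    unfolding wcoeff_star_mult_0 by (rule order_trans[OF norm_sum]) (simp add: norm_mult)
  also have "\<dots> \<le> (\<Sum>x\<in>?A. \<bar>cmod (wcoeff g x)\<bar> * \<bar>cmod (wcoeff h x)\<bar>)"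
    by (rule sum_mono2) auto
  also have "\<dots> \<le> l2norm g * l2norm h"
    using L2_set_mult_ineq[of "\<lambda>x. cmod (wcoeff g x)" "\<lambda>x. cmod (wcoeff h x)" ?A]
    by (subst (1 2) l2norm_superset[of ?A]) auto
  finally show ?thesis .
qed

lemma l2norm_wbasis_mult [simp]: "l2norm (wbasis x * g) = l2norm g"
proof -
  have "star (wbasis x * g) * (wbasis x * g) = star g * (wbasis (-x) * wbasis x * g)"
    by (simp add: star_mult mult.assoc)
  also have "wbasis (-x) * wbasis x = 1" by (simp add: wbasis_mult one_weyl_def)
  finally have "star (wbasis x * g) * (wbasis x * g) = star g * g" by simp
  then have "complex_of_real ((l2norm (wbasis x * g))\<^sup>2) = complex_of_real ((l2norm g)\<^sup>2)"
    by (metis wcoeff_star_self)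
  then show ?thesis by (simp only: of_real_eq_iff) (simp add: power2_eq_iff_nonneg)
qed

lemma l2norm_mult_le: "l2norm (f * g) \<le> (\<Sum>x\<in>wsupp f. cmod (wcoeff f x)) * l2norm g"
proof -
  have "l2norm ((\<Sum>x\<in>A. wcoeff f x *\<^sub>C wbasis x) * g) \<le> (\<Sum>x\<in>A. cmod (wcoeff f x)) * l2norm g"
    if "finite A" for A
    using that
  proof induction
    case (insert x A)
    then show ?case
      using l2norm_add[of "(wcoeff f x *\<^sub>C wbasis x) * g" "(\<Sum>x\<in>A. wcoeff f x *\<^sub>C wbasis x) * g"]
      by (simp add: ring_distribs l2norm_scaleC)
  qed simp
  then show ?thesis using weyl_expand[of f] by (metis finite_wsupp)
qed

definition regnorm :: "'h::complex_inner weyl \<Rightarrow> real" where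
  "regnorm f = Sup {l2norm (f * g) | g. l2norm g \<le> 1}"

lemma regnorm_bdd: "bdd_above {l2norm (f * g) | g. l2norm g \<le> 1}"
  for f :: "'h::complex_inner weyl"
proof (rule bdd_aboveI, clarify)
  fix g :: "'h weyl" assume "l2norm g \<le> 1"
  then have "(\<Sum>x\<in>wsupp f. cmod (wcoeff f x)) * l2norm g \<le> (\<Sum>x\<in>wsupp f. cmod (wcoeff f x)) * 1"
    by (intro mult_left_mono) (auto intro: sum_nonneg)
  then show "l2norm (f * g) \<le> (\<Sum>x\<in>wsupp f. cmod (wcoeff f x))"
    using l2norm_mult_le[of f g] by simp
qed

lemma regnorm_upper: "l2norm g \<le> 1 \<Longrightarrow> l2norm (f * g) \<le> regnorm f"
  unfolding regnorm_def by (rule cSup_upper[OF _ regnorm_bdd]) auto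

lemma regnorm_leI: "(\<And>g. l2norm g \<le> 1 \<Longrightarrow> l2norm (f * g) \<le> B) \<Longrightarrow> regnorm f \<le> B"
  unfolding regnorm_def by (rule cSup_least) (auto intro!: exI[of _ 0])

lemma regnorm_nonneg: "0 \<le> regnorm f"
  using regnorm_upper[of 0 f] by simp

lemma l2norm_mult_le_regnorm: "l2norm (f * g) \<le> regnorm f * l2norm g"
proof (cases "l2norm g = 0")
  case True
  then have "g = 0" by (rule l2norm_eq_0)
  then show ?thesis by simp
next
  case False
  then have pos: "0 < l2norm g" using l2norm_nonneg[of g] by linarith
  let ?c = "complex_of_real (inverse (l2norm g))"
  have "l2norm (?c *\<^sub>C g) \<le> 1" using pos by (simp add: l2norm_scaleC norm_inverse)
  then have "l2norm (f * (?c *\<^sub>C g)) \<le> regnorm f" by (rule regnorm_upper)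
  then show ?thesis using pos by (simp add: l2norm_scaleC norm_divide norm_inverse field_simps)
qed

lemma cstar_seminorm_regnorm: "cstar_seminorm (regnorm :: 'h::complex_inner weyl \<Rightarrow> real)"
  unfolding cstar_seminorm_def
proof (intro conjI allI)
  fix f g :: "'h weyl" and c :: complex
  show "regnorm (f + g) \<le> regnorm f + regnorm g"
  proof (rule regnorm_leI)
    fix h :: "'h weyl" assume h: "l2norm h \<le> 1"
    show "l2norm ((f + g) * h) \<le> regnorm f + regnorm g"
      using l2norm_add[of "f * h" "g * h"] regnorm_upper[OF h, of f] regnorm_upper[OF h, of g]
      by (simp add: ring_distribs)
  qed
  have le: "regnorm (c *\<^sub>C f) \<le> cmod c * regnorm f" for c and f :: "'h weyl"
    by (rule regnorm_leI) (auto simp: l2norm_scaleC intro!: mult_left_mono regnorm_upper)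
  show "regnorm (c *\<^sub>C f) = cmod c * regnorm f"
  proof (cases "c = 0")
    case True
    then show ?thesis using le[of 0 f] regnorm_nonneg[of "0 *\<^sub>C f"] by simp
  next
    case False
    have "regnorm f \<le> cmod (inverse c) * regnorm (c *\<^sub>C f)" using le[of "inverse c" "c *\<^sub>C f"] False by simp
    then have "cmod c * regnorm f \<le> regnorm (c *\<^sub>C f)"
      using False by (simp add: norm_divide norm_inverse field_simps)
    then show ?thesis using le[of c f] by simp
  qed
  show sm: "regnorm (f * g) \<le> regnorm f * regnorm g" for f g :: "'h weyl"
  proof (rule regnorm_leI)
    fix h :: "'h weyl" assume h: "l2norm h \<le> 1"
    have "l2norm (f * g * h) \<le> regnorm f * l2norm (g * h)"
      using l2norm_mult_le_regnorm[of f "g * h"] by (simp add: mult.assoc)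
    also have "\<dots> \<le> regnorm f * regnorm g"
      by (intro mult_left_mono regnorm_upper h regnorm_nonneg)
    finally show "l2norm (f * g * h) \<le> regnorm f * regnorm g" .
  qed
  have ge: "(regnorm f)\<^sup>2 \<le> regnorm (star f * f)" for f :: "'h weyl"
  proof -
    have "regnorm f \<le> sqrt (regnorm (star f * f))"
    proof (rule regnorm_leI)
      fix g :: "'h weyl" assume g: "l2norm g \<le> 1"
      have "(l2norm (f * g))\<^sup>2 = cmod (wcoeff (star (f * g) * (f * g)) 0)"
        by (simp add: wcoeff_star_self del: of_real_power)
      also have "star (f * g) * (f * g) = star g * (star f * f * g)"
        by (simp add: star_mult mult.assoc)
      also have "cmod (wcoeff \<dots> 0) \<le> l2norm (star f * f * g) * l2norm g"
        by (rule wcoeff_star_mult_le)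
      also have "\<dots> \<le> regnorm (star f * f) * 1"
        by (intro mult_mono regnorm_upper g regnorm_nonneg) auto
      finally show "l2norm (f * g) \<le> sqrt (regnorm (star f * f))" by (simp add: real_le_rsqrt)
    qed
    then show ?thesis by (metis real_sqrt_pow2 power_mono regnorm_nonneg)
  qed
  have st: "regnorm f \<le> regnorm (star f)" for f :: "'h weyl"
  proof (cases "regnorm f = 0")
    case False
    then have "0 < regnorm f" using regnorm_nonneg[of f] by linarith
    moreover have "regnorm f * regnorm f \<le> regnorm (star f) * regnorm f"
      using ge[of f] sm[of "star f" f] by (simp add: power2_eq_square)
    ultimately show ?thesis by simp
  qed (simp add: regnorm_nonneg)
  have "regnorm (star f) = regnorm f" using st[of f] st[of "star f"] by simp
  then show "regnorm (star f * f) = (regnorm f)\<^sup>2"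
    using ge[of f] sm[of "star f" f] by (simp add: power2_eq_square)
qed

lemma wnorm_eq_0: "wnorm f = 0 \<Longrightarrow> f = 0"
proof (rule l2norm_eq_0)
  assume "wnorm f = 0"
  then have r: "regnorm f \<le> 0" using cstar_seminorm_le_wnorm[OF cstar_seminorm_regnorm, of f] by simp
  have "wsupp (1 :: 'a weyl) = {0}"
    by (auto simp: wsupp_iff one_weyl_def wcoeff_basis split: if_splits)
  then have "l2norm (1 :: 'a weyl) \<le> 1" by (simp add: l2norm_def one_weyl_def wcoeff_basis)
  from regnorm_upper[OF this, of f] have "l2norm f \<le> 0" using r by simp
  then show "l2norm f = 0" using l2norm_nonneg[of f] by linarith
qed

instantiation weyl :: (complex_inner) pre_cstar_algebra
begin
definition norm_weyl :: "'a weyl \<Rightarrow> real" where "norm_weyl = wnorm"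
definition sgn_weyl :: "'a weyl \<Rightarrow> 'a weyl" where "sgn_weyl f = f /\<^sub>R norm f"
definition dist_weyl :: "'a weyl \<Rightarrow> 'a weyl \<Rightarrow> real" where "dist_weyl f g = norm (f - g)"
definition uniformity_weyl :: "('a weyl \<times> 'a weyl) filter" where
  "uniformity_weyl = (INF e\<in>{0<..}. principal {(f, g). dist f g < e})"
definition open_weyl :: "'a weyl set \<Rightarrow> bool" where
  "open_weyl U \<longleftrightarrow> (\<forall>f\<in>U. \<forall>\<^sub>F (f', g) in uniformity. f' = f \<longrightarrow> g \<in> U)"
instance
proof
  note s = cstar_seminormD[OF cstar_seminorm_wnorm]
  fix f g :: "'a weyl" and U :: "'a weyl set" and r :: real
  show "dist f g = norm (f - g)" by (rule dist_weyl_def)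
  show "sgn f = f /\<^sub>R norm f" by (rule sgn_weyl_def)
  show "(uniformity :: ('a weyl \<times> 'a weyl) filter) = (INF e\<in>{0<..}. principal {(f, g). dist f g < e})"
    by (rule uniformity_weyl_def)
  show "open U = (\<forall>f\<in>U. \<forall>\<^sub>F (f', g) in uniformity. f' = f \<longrightarrow> g \<in> U)"
    by (rule open_weyl_def)
  have z: "wnorm (0 :: 'a weyl) = 0" using s(2)[of 0 0] by simp
  then show "norm f = 0 \<longleftrightarrow> f = 0" by (auto simp: norm_weyl_def wnorm_eq_0)
  show "norm (f + g) \<le> norm f + norm g" "norm (f * g) \<le> norm f * norm g"
    "norm (star f * f) = (norm f)\<^sup>2"
    by (simp_all add: norm_weyl_def s)
  show "norm (r *\<^sub>R f) = \<bar>r\<bar> * norm f" by (simp add: norm_weyl_def scaleR_scaleC s)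
  have "wnorm (1 :: 'a weyl) \<noteq> 0" using wnorm_eq_0[of "1 :: 'a weyl"] by auto
  moreover have "wnorm (1 :: 'a weyl) = (wnorm (1 :: 'a weyl))\<^sup>2" using s(4)[of "1 :: 'a weyl"] by (simp only: star_one mult_1_left)
  ultimately show "norm (1 :: 'a weyl) = 1" by (simp add: norm_weyl_def power2_eq_square)
qed
end


section \<open>Completion of a normed *-algebra with the C*-identity\<close>

definition cauchy_eq :: "(nat \<Rightarrow> 'a::real_normed_vector) \<Rightarrow> (nat \<Rightarrow> 'a) \<Rightarrow> bool" where
  "cauchy_eq X Y \<longleftrightarrow> Cauchy X \<and> Cauchy Y \<and> (\<lambda>n. X n - Y n) \<longlonglongrightarrow> 0"

lemma cauchy_eq_refl [simp]: "cauchy_eq X X \<longleftrightarrow> Cauchy X"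
  by (simp add: cauchy_eq_def)

lemma Cauchy_const [simp]: "Cauchy (\<lambda>n. c :: 'a::real_normed_vector)"
  by (rule CauchyI) auto

lemma part_equivp_cauchy_eq: "part_equivp (cauchy_eq :: (nat \<Rightarrow> 'a::real_normed_vector) \<Rightarrow> _)"
proof (rule part_equivpI)
  show "\<exists>X :: nat \<Rightarrow> 'a. cauchy_eq X X" by (rule exI[of _ "\<lambda>n. 0"]) simp
  show "symp_on UNIV (cauchy_eq :: (nat \<Rightarrow> 'a) \<Rightarrow> _)"
  proof (rule sympI)
    fix X Y :: "nat \<Rightarrow> 'a" assume "cauchy_eq X Y"
    then show "cauchy_eq Y X"
      using tendsto_minus[of "\<lambda>n. X n - Y n" 0 sequentially] by (simp add: cauchy_eq_def)
  qed
  show "transp_on UNIV (cauchy_eq :: (nat \<Rightarrow> 'a) \<Rightarrow> _)"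
  proof (rule transpI)
    fix X Y Z :: "nat \<Rightarrow> 'a" assume "cauchy_eq X Y" "cauchy_eq Y Z"
    then show "cauchy_eq X Z"
      using tendsto_add[of "\<lambda>n. X n - Y n" 0 sequentially "\<lambda>n. Y n - Z n" 0]
      by (simp add: cauchy_eq_def)
  qed
qed

lemma Cauchy_dominated:
  fixes X :: "nat \<Rightarrow> 'a::real_normed_vector" and Y :: "nat \<Rightarrow> 'b::real_normed_vector"
    and Z :: "nat \<Rightarrow> 'c::real_normed_vector"
  assumes X: "Cauchy X" and Y: "Cauchy Y" and K: "K > 0"
    and Z: "\<And>m n. norm (Z m - Z n) \<le> K * (norm (X m - X n) + norm (Y m - Y n))"
  shows "Cauchy Z"
proof (rule CauchyI)
  fix e :: real assume "e > 0"
  then have e: "e / (2 * K) > 0" using K by simp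
  from CauchyD[OF X e] obtain M where M: "\<forall>m\<ge>M. \<forall>n\<ge>M. norm (X m - X n) < e / (2 * K)" ..
  from CauchyD[OF Y e] obtain N where N: "\<forall>m\<ge>N. \<forall>n\<ge>N. norm (Y m - Y n) < e / (2 * K)" ..
  show "\<exists>M. \<forall>m\<ge>M. \<forall>n\<ge>M. norm (Z m - Z n) < e"
  proof (intro exI allI impI)
    fix m n assume "m \<ge> max M N" "n \<ge> max M N"
    then have "norm (X m - X n) + norm (Y m - Y n) < e / (2 * K) + e / (2 * K)"
      using M N by (intro add_strict_mono) auto
    then have "K * (norm (X m - X n) + norm (Y m - Y n)) < e" using K by (simp add: field_simps)
    then show "norm (Z m - Z n) < e" using Z[of m n] by linarith
  qed
qed

lemma Cauchy_add:
  fixes X Y :: "nat \<Rightarrow> 'a::real_normed_vector"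
  assumes "Cauchy X" "Cauchy Y" shows "Cauchy (\<lambda>n. X n + Y n)"
proof (rule Cauchy_dominated[OF assms, of 1])
  fix m n
  have "X m + Y m - (X n + Y n) = (X m - X n) + (Y m - Y n)" by simp
  then show "norm (X m + Y m - (X n + Y n)) \<le> 1 * (norm (X m - X n) + norm (Y m - Y n))"
    by (metis mult_1 norm_triangle_ineq)
qed simp

lemma Cauchy_uminus:
  fixes X :: "nat \<Rightarrow> 'a::real_normed_vector"
  assumes "Cauchy X" shows "Cauchy (\<lambda>n. - X n)"
proof (rule Cauchy_dominated[OF assms assms, of 1])
  fix m n
  have "- X m - - X n = - (X m - X n)" by simp
  then show "norm (- X m - - X n) \<le> 1 * (norm (X m - X n) + norm (X m - X n))"
    by (simp only: norm_minus_cancel) simp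
qed simp

lemma Cauchy_minus:
  fixes X Y :: "nat \<Rightarrow> 'a::real_normed_vector"
  assumes "Cauchy X" "Cauchy Y" shows "Cauchy (\<lambda>n. X n - Y n)"
  using Cauchy_add[OF assms(1) Cauchy_uminus[OF assms(2)]] by simp

lemma Cauchy_scaleC:
  fixes X :: "nat \<Rightarrow> 'a::pre_cstar_algebra"
  assumes "Cauchy X" shows "Cauchy (\<lambda>n. c *\<^sub>C X n)"
proof (rule Cauchy_dominated[OF assms assms, of "cmod c + 1"])
  fix m n
  have "norm (c *\<^sub>C X m - c *\<^sub>C X n) = cmod c * norm (X m - X n)"
    by (simp flip: complex_vector.scale_right_diff_distrib)
  also have "\<dots> \<le> (cmod c + 1) * (norm (X m - X n) + norm (X m - X n))"
    by (intro mult_mono) auto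
  finally show "norm (c *\<^sub>C X m - c *\<^sub>C X n) \<le> \<dots>" .
qed (simp add: add_nonneg_pos)

lemma Cauchy_star:
  fixes X :: "nat \<Rightarrow> 'a::pre_cstar_algebra"
  assumes "Cauchy X" shows "Cauchy (\<lambda>n. star (X n))"
  by (rule Cauchy_dominated[OF assms assms, of 1]) (auto simp flip: star_diff)

lemma Cauchy_mult:
  fixes X Y :: "nat \<Rightarrow> 'a::real_normed_algebra"
  assumes "Cauchy X" "Cauchy Y" shows "Cauchy (\<lambda>n. X n * Y n)"
proof -
  obtain B where B: "B > 0" "\<And>n. norm (X n) \<le> B"
    using Cauchy_Bseq[OF assms(1)] by (auto elim: BseqE)
  obtain C where C: "C > 0" "\<And>n. norm (Y n) \<le> C"
    using Cauchy_Bseq[OF assms(2)] by (auto elim: BseqE)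
  show ?thesis
  proof (rule Cauchy_dominated[OF assms, of "max B C"])
    fix m n
    have "X m * Y m - X n * Y n = (X m - X n) * Y m + X n * (Y m - Y n)"
      by (simp add: algebra_simps)
    then have "norm (X m * Y m - X n * Y n) \<le> norm (X m - X n) * norm (Y m) + norm (X n) * norm (Y m - Y n)"
      by (metis add_mono norm_mult_ineq norm_triangle_le)
    also have "\<dots> \<le> norm (X m - X n) * max B C + max B C * norm (Y m - Y n)"
      using B(2)[of n] C(2)[of m] B(1)
      by (intro add_mono mult_mono) auto
    finally show "norm (X m * Y m - X n * Y n) \<le> max B C * (norm (X m - X n) + norm (Y m - Y n))"
      by (simp add: algebra_simps)
  qed (use B in simp)
qed

lemmas Cauchy_intros = Cauchy_add Cauchy_uminus Cauchy_minus Cauchy_scaleC Cauchy_star Cauchy_mult Cauchy_const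

lemma Cauchy_convergent_norm:
  fixes X :: "nat \<Rightarrow> 'a::real_normed_vector"
  assumes "Cauchy X" shows "convergent (\<lambda>n. norm (X n))"
proof -
  have "Cauchy (\<lambda>n. norm (X n))"
  proof (rule Cauchy_dominated[OF assms assms, of 1])
    show "norm (norm (X m) - norm (X n)) \<le> 1 * (norm (X m - X n) + norm (X m - X n))" for m n
      using norm_triangle_ineq3[of "X m" "X n"] by (smt (verit) norm_ge_zero real_norm_def)
  qed simp
  then show ?thesis by (rule Cauchy_convergent)
qed

lemma Cauchy_norm_LIMSEQ: "Cauchy X \<Longrightarrow> (\<lambda>n. norm (X n)) \<longlonglongrightarrow> lim (\<lambda>n. norm (X n))"
  using Cauchy_convergent_norm convergent_LIMSEQ_iff by blast

lemma cauchy_eq_lim_norm: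
  assumes "cauchy_eq X Y" shows "lim (\<lambda>n. norm (X n)) = lim (\<lambda>n. norm (Y n))"
proof -
  have "(\<lambda>n. norm (X n) - norm (Y n)) \<longlonglongrightarrow> 0"
    by (rule Lim_null_comparison[OF _ tendsto_norm_zero])
      (use assms in \<open>auto simp: cauchy_eq_def intro!: always_eventually norm_triangle_ineq3\<close>)
  moreover have "(\<lambda>n. norm (Y n)) \<longlonglongrightarrow> lim (\<lambda>n. norm (Y n))"
    using assms by (auto simp: cauchy_eq_def intro: Cauchy_norm_LIMSEQ)
  ultimately have "(\<lambda>n. norm (X n)) \<longlonglongrightarrow> lim (\<lambda>n. norm (Y n))"
    using tendsto_add by fastforce
  then show ?thesis by (rule limI)
qed

quotient_type (overloaded) 'a completion = "nat \<Rightarrow> 'a::pre_cstar_algebra" / partial: cauchy_eq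
  by (rule part_equivp_cauchy_eq)

lemma completion_cases:
  obtains X where "Cauchy X" "x = abs_completion X"
  using Quotient3_completion
  by (metis Quotient3_def cauchy_eq_refl)

instantiation completion :: (pre_cstar_algebra) star_algebra
begin

lift_definition zero_completion :: "'a completion" is "\<lambda>n. 0" by simp
lift_definition one_completion :: "'a completion" is "\<lambda>n. 1" by simp
lift_definition plus_completion :: "'a completion \<Rightarrow> 'a completion \<Rightarrow> 'a completion"
  is "\<lambda>X Y n. X n + Y n"
  unfolding cauchy_eq_def by (auto intro: Cauchy_add simp: add_diff_add intro!: tendsto_add_zero)
lift_definition minus_completion :: "'a completion \<Rightarrow> 'a completion \<Rightarrow> 'a completion"
  is "\<lambda>X Y n. X n - Y n"
proof -
  fix X X' Y Y' :: "nat \<Rightarrow> 'a" assume "cauchy_eq X X'" "cauchy_eq Y Y'"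
  then show "cauchy_eq (\<lambda>n. X n - Y n) (\<lambda>n. X' n - Y' n)"
    using tendsto_diff[of "\<lambda>n. X n - X' n" 0 sequentially "\<lambda>n. Y n - Y' n" 0]
    unfolding cauchy_eq_def by (auto intro: Cauchy_minus simp: algebra_simps)
qed
lift_definition uminus_completion :: "'a completion \<Rightarrow> 'a completion"
  is "\<lambda>X n. - X n"
proof -
  fix X X' :: "nat \<Rightarrow> 'a" assume "cauchy_eq X X'"
  then show "cauchy_eq (\<lambda>n. - X n) (\<lambda>n. - X' n)"
    using tendsto_minus[of "\<lambda>n. X n - X' n" 0 sequentially]
    unfolding cauchy_eq_def by (auto intro: Cauchy_uminus)
qed
lift_definition times_completion :: "'a completion \<Rightarrow> 'a completion \<Rightarrow> 'a completion"
  is "\<lambda>X Y n. X n * Y n"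
proof -
  fix X X' Y Y' :: "nat \<Rightarrow> 'a" assume "cauchy_eq X X'" "cauchy_eq Y Y'"
  then have c: "Cauchy X" "Cauchy X'" "Cauchy Y" "Cauchy Y'"
    and l: "(\<lambda>n. X n - X' n) \<longlonglongrightarrow> 0" "(\<lambda>n. Y n - Y' n) \<longlonglongrightarrow> 0"
    by (auto simp: cauchy_eq_def)
  have "(\<lambda>n. (X n - X' n) * Y n) \<longlonglongrightarrow> 0" "(\<lambda>n. X' n * (Y n - Y' n)) \<longlonglongrightarrow> 0"
    using bounded_bilinear.Zfun_prod_Bfun[OF bounded_bilinear_mult] l
      bounded_bilinear.Bfun_prod_Zfun[OF bounded_bilinear_mult] Cauchy_Bseq[OF c(3)] Cauchy_Bseq[OF c(2)]
    by (auto simp: tendsto_Zfun_iff)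
  from tendsto_add[OF this] have "(\<lambda>n. X n * Y n - X' n * Y' n) \<longlonglongrightarrow> 0"
    by (simp add: algebra_simps)
  then show "cauchy_eq (\<lambda>n. X n * Y n) (\<lambda>n. X' n * Y' n)"
    using c by (auto simp: cauchy_eq_def intro: Cauchy_mult)
qed
lift_definition scaleC_completion :: "complex \<Rightarrow> 'a completion \<Rightarrow> 'a completion"
  is "\<lambda>c X n. c *\<^sub>C X n"
proof -
  fix c and X X' :: "nat \<Rightarrow> 'a" assume "cauchy_eq X X'"
  then have c: "Cauchy X" "Cauchy X'" and l: "(\<lambda>n. norm (X n - X' n)) \<longlonglongrightarrow> 0"
    by (auto simp: cauchy_eq_def tendsto_norm_zero_iff)
  have "(\<lambda>n. norm (c *\<^sub>C X n - c *\<^sub>C X' n)) \<longlonglongrightarrow> 0"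
    using tendsto_mult_right_zero[OF l, of "cmod c"] by (simp flip: complex_vector.scale_right_diff_distrib)
  then show "cauchy_eq (\<lambda>n. c *\<^sub>C X n) (\<lambda>n. c *\<^sub>C X' n)"
    using c by (auto simp: cauchy_eq_def tendsto_norm_zero_iff intro: Cauchy_scaleC)
qed
definition scaleR_completion :: "real \<Rightarrow> 'a completion \<Rightarrow> 'a completion" where
  "scaleR_completion r x = complex_of_real r *\<^sub>C x"
lift_definition star_completion :: "'a completion \<Rightarrow> 'a completion"
  is "\<lambda>X n. star (X n)"
proof -
  fix X X' :: "nat \<Rightarrow> 'a" assume "cauchy_eq X X'"
  then have c: "Cauchy X" "Cauchy X'" and l: "(\<lambda>n. norm (X n - X' n)) \<longlonglongrightarrow> 0"
    by (auto simp: cauchy_eq_def tendsto_norm_zero_iff)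
  have "(\<lambda>n. norm (star (X n) - star (X' n))) \<longlonglongrightarrow> 0"
    using l by (simp flip: star_diff)
  then show "cauchy_eq (\<lambda>n. star (X n)) (\<lambda>n. star (X' n))"
    using c by (auto simp: cauchy_eq_def tendsto_norm_zero_iff intro: Cauchy_star)
qed

instance
proof
  fix x y z :: "'a completion" and c d :: complex and r s :: real
  show "x + y + z = x + (y + z)" by transfer (simp add: add.assoc Cauchy_intros)
  show "x + y = y + x" by transfer (simp add: add.commute Cauchy_intros)
  show "0 + x = x" by transfer simp
  show "- x + x = 0" by transfer simp
  show "x - y = x + - y" by transfer (simp add: Cauchy_intros)
  show a: "c *\<^sub>C (x + y) = c *\<^sub>C x + c *\<^sub>C y" for c and x y :: "'a completion"
    by transfer (simp add: scaleC_add_right Cauchy_intros)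
  show b: "(c + d) *\<^sub>C x = c *\<^sub>C x + d *\<^sub>C x" for c d and x :: "'a completion"
    by transfer (simp add: scaleC_add_left Cauchy_intros)
  show e: "c *\<^sub>C d *\<^sub>C x = (c * d) *\<^sub>C x" for c d and x :: "'a completion"
    by transfer (simp add: Cauchy_intros)
  show f: "1 *\<^sub>C x = x" for x :: "'a completion"
    by transfer simp
  show "r *\<^sub>R x = complex_of_real r *\<^sub>C x" by (simp add: scaleR_completion_def)
  show "r *\<^sub>R (x + y) = r *\<^sub>R x + r *\<^sub>R y" "(r + s) *\<^sub>R x = r *\<^sub>R x + s *\<^sub>R x"
    "r *\<^sub>R s *\<^sub>R x = (r * s) *\<^sub>R x" "1 *\<^sub>R x = x"
    by (simp_all add: scaleR_completion_def a b e f)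
  show "x * y * z = x * (y * z)" by transfer (simp add: mult.assoc Cauchy_intros)
  show "1 * x = x" "x * 1 = x" by (transfer; simp)+
  show "(x + y) * z = x * z + y * z" by transfer (simp add: distrib_right Cauchy_intros)
  show "x * (y + z) = x * y + x * z" by transfer (simp add: distrib_left Cauchy_intros)
  show "(0 :: 'a completion) \<noteq> 1" by transfer (simp add: cauchy_eq_def LIMSEQ_const_iff)
  show l: "(c *\<^sub>C x) * y = c *\<^sub>C (x * y)" for c and x y :: "'a completion"
    by transfer (simp add: Cauchy_intros)
  show r: "x * (c *\<^sub>C y) = c *\<^sub>C (x * y)" for c and x y :: "'a completion"
    by transfer (simp add: Cauchy_intros)
  show "(r *\<^sub>R x) * y = r *\<^sub>R (x * y)" "x * (r *\<^sub>R y) = r *\<^sub>R (x * y)"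
    by (simp_all add: scaleR_completion_def l r)
  show "star (x + y) = star x + star y" by transfer (simp add: star_add Cauchy_intros)
  show "star (c *\<^sub>C x) = cnj c *\<^sub>C star x" by transfer (simp add: star_scaleC Cauchy_intros)
  show "star (x * y) = star y * star x" by transfer (simp add: star_mult Cauchy_intros)
  show "star (star x) = x" by transfer simp
qed

end

instantiation completion :: (pre_cstar_algebra) pre_cstar_algebra
begin

lift_definition norm_completion :: "'a completion \<Rightarrow> real" is "\<lambda>X. lim (\<lambda>n. norm (X n))"
  by (rule cauchy_eq_lim_norm)
definition sgn_completion :: "'a completion \<Rightarrow> 'a completion" where
  "sgn_completion x = x /\<^sub>R norm x"
definition dist_completion :: "'a completion \<Rightarrow> 'a completion \<Rightarrow> real" where
  "dist_completion x y = norm (x - y)"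
definition uniformity_completion :: "('a completion \<times> 'a completion) filter" where
  "uniformity_completion = (INF e\<in>{0<..}. principal {(x, y). dist x y < e})"
definition open_completion :: "'a completion set \<Rightarrow> bool" where
  "open_completion U \<longleftrightarrow> (\<forall>x\<in>U. \<forall>\<^sub>F (x', y) in uniformity. x' = x \<longrightarrow> y \<in> U)"

instance
proof
  fix x y :: "'a completion" and U :: "'a completion set" and r :: real
  show "dist x y = norm (x - y)" by (rule dist_completion_def)
  show "sgn x = x /\<^sub>R norm x" by (rule sgn_completion_def)
  show "(uniformity :: ('a completion \<times> 'a completion) filter) = (INF e\<in>{0<..}. principal {(x, y). dist x y < e})"
    by (rule uniformity_completion_def)
  show "open U = (\<forall>x\<in>U. \<forall>\<^sub>F (x', y) in uniformity. x' = x \<longrightarrow> y \<in> U)"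
    by (rule open_completion_def)
  show "norm x = 0 \<longleftrightarrow> x = 0"
  proof (transfer, unfold cauchy_eq_refl)
    fix X :: "nat \<Rightarrow> 'a" assume X: "Cauchy X"
    show "lim (\<lambda>n. norm (X n)) = 0 \<longleftrightarrow> cauchy_eq X (\<lambda>n. 0)"
      using Cauchy_norm_LIMSEQ[OF X] X
      by (auto simp: cauchy_eq_def tendsto_norm_zero_iff intro: limI tendsto_norm_zero)
  qed
  show "norm (x + y) \<le> norm x + norm y"
  proof (transfer, unfold cauchy_eq_refl)
    fix X Y :: "nat \<Rightarrow> 'a" assume X: "Cauchy X" and Y: "Cauchy Y"
    show "lim (\<lambda>n. norm (X n + Y n)) \<le> lim (\<lambda>n. norm (X n)) + lim (\<lambda>n. norm (Y n))"
      by (rule LIMSEQ_le[OF Cauchy_norm_LIMSEQ[OF Cauchy_add[OF X Y]]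
            tendsto_add[OF Cauchy_norm_LIMSEQ[OF X] Cauchy_norm_LIMSEQ[OF Y]]])
        (auto intro: norm_triangle_ineq)
  qed
  show "norm (x * y) \<le> norm x * norm y"
  proof (transfer, unfold cauchy_eq_refl)
    fix X Y :: "nat \<Rightarrow> 'a" assume X: "Cauchy X" and Y: "Cauchy Y"
    show "lim (\<lambda>n. norm (X n * Y n)) \<le> lim (\<lambda>n. norm (X n)) * lim (\<lambda>n. norm (Y n))"
      by (rule LIMSEQ_le[OF Cauchy_norm_LIMSEQ[OF Cauchy_mult[OF X Y]]
            tendsto_mult[OF Cauchy_norm_LIMSEQ[OF X] Cauchy_norm_LIMSEQ[OF Y]]])
        (auto intro: norm_mult_ineq)
  qed
  have "norm (c *\<^sub>C x) = cmod c * norm x" for c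
  proof (transfer, unfold cauchy_eq_refl)
    fix c and X :: "nat \<Rightarrow> 'a" assume X: "Cauchy X"
    show "lim (\<lambda>n. norm (c *\<^sub>C X n)) = cmod c * lim (\<lambda>n. norm (X n))"
      by (simp, intro limI tendsto_mult_left Cauchy_norm_LIMSEQ X)
  qed
  then show "norm (r *\<^sub>R x) = \<bar>r\<bar> * norm x" by (simp add: scaleR_completion_def)
  show "norm (1 :: 'a completion) = 1" by transfer (simp add: lim_const)
  show "norm (star x * x) = (norm x)\<^sup>2"
  proof (transfer, unfold cauchy_eq_refl)
    fix X :: "nat \<Rightarrow> 'a" assume X: "Cauchy X"
    show "lim (\<lambda>n. norm (star (X n) * X n)) = (lim (\<lambda>n. norm (X n)))\<^sup>2"
      by (simp add: cstar_identity, intro limI tendsto_power Cauchy_norm_LIMSEQ X)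
  qed
qed

end

lift_definition completion_of :: "'a::pre_cstar_algebra \<Rightarrow> 'a completion" is "\<lambda>a n. a" by simp

lemma norm_completion_of [simp]: "norm (completion_of a) = norm a"
  by transfer (simp add: lim_const)

lemma completion_of_simps:
  "completion_of 0 = 0" "completion_of 1 = 1" "completion_of (a + b) = completion_of a + completion_of b"
  "completion_of (a - b) = completion_of a - completion_of b"
  "completion_of (c *\<^sub>C a) = c *\<^sub>C completion_of a" "completion_of (a * b) = completion_of a * completion_of b"
  "completion_of (star a) = star (completion_of a)"
  by (transfer; simp)+

lemma completion_of_LIMSEQ:
  assumes X: "Cauchy X" shows "(\<lambda>n. completion_of (X n)) \<longlonglongrightarrow> abs_completion X"
proof (rule LIMSEQ_I)
  fix e :: real assume e: "e > 0"
  then have e2: "e / 2 > 0" by simp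
  from CauchyD[OF X e2] obtain M where M: "\<And>m n. m \<ge> M \<Longrightarrow> n \<ge> M \<Longrightarrow> norm (X m - X n) < e / 2" by auto
  show "\<exists>M. \<forall>n\<ge>M. norm (completion_of (X n) - abs_completion X) < e"
  proof (intro exI allI impI)
    fix m assume m: "m \<ge> M"
    have C: "Cauchy (\<lambda>n. X m - X n)" by (intro Cauchy_intros X)
    have "completion_of (X m) - abs_completion X = abs_completion (\<lambda>n. X m - X n)"
      using X by (simp add: completion_of.abs_eq minus_completion.abs_eq)
    then have "norm (completion_of (X m) - abs_completion X) = lim (\<lambda>n. norm (X m - X n))"
      using C by (simp add: norm_completion.abs_eq)
    also have "\<dots> \<le> e / 2"
      using M m by (intro LIMSEQ_le_const2[OF Cauchy_norm_LIMSEQ[OF C]] exI[of _ M]) (auto intro: less_imp_le)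
    finally show "norm (completion_of (X m) - abs_completion X) < e" using e by simp
  qed
qed

lemma completion_of_dense:
  assumes "e > 0" obtains a where "norm (x - completion_of a) < e"
proof -
  obtain X where X: "Cauchy X" "x = abs_completion X" by (rule completion_cases)
  from LIMSEQ_D[OF completion_of_LIMSEQ[OF X(1)] assms] obtain n where
    "norm (completion_of (X n) - x) < e" unfolding X(2) by blast
  then show thesis by (metis norm_minus_commute that)
qed

instance completion :: (pre_cstar_algebra) cstar_algebra
proof
  fix S :: "nat \<Rightarrow> 'a completion" assume S: "Cauchy S"
  have "\<exists>a. norm (S n - completion_of a) < 1 / real (Suc n)" for n
    using completion_of_dense[of "1 / real (Suc n)" "S n"] by auto
  then obtain A where A: "\<And>n. norm (S n - completion_of (A n)) < 1 / real (Suc n)" by metis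
  have z: "(\<lambda>n. S n - completion_of (A n)) \<longlonglongrightarrow> 0"
    by (rule Lim_null_comparison[OF _ lim_1_over_n[THEN LIMSEQ_Suc]])
      (auto intro!: always_eventually less_imp_le simp: A simp del: of_nat_Suc)
  have "Cauchy (\<lambda>n. S n - (S n - completion_of (A n)))"
    by (intro Cauchy_minus S LIMSEQ_imp_Cauchy[OF z])
  then have "Cauchy (\<lambda>n. completion_of (A n))" by simp
  then have "Cauchy A"
    by (simp add: Cauchy_iff flip: completion_of_simps)
  then have "(\<lambda>n. completion_of (A n)) \<longlonglongrightarrow> abs_completion A" by (rule completion_of_LIMSEQ)
  from tendsto_add[OF z this] show "convergent S" by (auto simp: convergent_def)
qed


section \<open>The C*-algebra of the canonical commutation relations\<close>

type_synonym 'h ccr = "'h weyl completion"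

definition weyl_elem :: "'h::complex_inner \<Rightarrow> 'h ccr" where
  "weyl_elem x = completion_of (wbasis x)"

definition star_hom :: "('a::star_algebra \<Rightarrow> 'b::star_algebra) \<Rightarrow> bool" where
  "star_hom \<pi> \<longleftrightarrow> (\<forall>a b. \<pi> (a + b) = \<pi> a + \<pi> b) \<and> (\<forall>c a. \<pi> (c *\<^sub>C a) = c *\<^sub>C \<pi> a) \<and>
     (\<forall>a b. \<pi> (a * b) = \<pi> a * \<pi> b) \<and> (\<forall>a. \<pi> (star a) = star (\<pi> a))"

lemma weyl_relations_elem: "weyl_relations weyl_elem"
  by (simp add: weyl_relations_def weyl_elem_def wbasis_mult phase_def flip: completion_of_simps)

lemma wext_star_hom:
  assumes V: "weyl_relations (V :: 'h::complex_inner \<Rightarrow> 'a::star_algebra)"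
  shows "star_hom (wext V)"
proof -
  have V1: "star (V x) = V (- x)" and V2: "V x * V y = phase x y *\<^sub>C V (x + y)" for x y
    using V by (auto simp: weyl_relations_def phase_def)
  have m1: "wext V (wbasis x * g) = V x * wext V g" for x g
    by (induction g rule: weyl_induct) (simp_all add: ring_distribs wbasis_mult V2)
  have m: "wext V (f * g) = wext V f * wext V g" for f g
    by (induction f rule: weyl_induct) (simp_all add: ring_distribs m1)
  have s: "wext V (star f) = star (wext V f)" for f
    by (induction f rule: weyl_induct) (simp_all add: star_add star_scaleC V1)
  show ?thesis by (simp add: star_hom_def m s)
qed

lemma star_hom_norm_wext_le:
  assumes "weyl_relations (V :: 'h::complex_inner \<Rightarrow> 'a::cstar_algebra)"
  shows "norm (wext V f) \<le> norm f"
proof -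
  have h: "wext V (f * g) = wext V f * wext V g" "wext V (star f) = star (wext V f)" for f g
    using wext_star_hom[OF assms] by (auto simp: star_hom_def)
  have "cstar_seminorm (\<lambda>f. norm (wext V f))"
    by (auto simp: cstar_seminorm_def h norm_triangle_ineq norm_mult_ineq cstar_identity)
  from cstar_seminorm_le_wnorm[OF this, of f] show ?thesis by (simp add: norm_weyl_def)
qed

lemma span_weyl_elem: "complex_vector.span (range weyl_elem) = range completion_of"
proof (rule antisym)
  have "complex_vector.subspace (range (completion_of :: 'a weyl \<Rightarrow> 'a ccr))"
    unfolding complex_vector.subspace_def
    by (auto simp flip: completion_of_simps)
  then show "complex_vector.span (range weyl_elem) \<subseteq> range (completion_of :: 'a weyl \<Rightarrow> 'a ccr)"
    by (intro complex_vector.span_minimal) (auto simp: weyl_elem_def)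
  have "completion_of f \<in> complex_vector.span (range weyl_elem)" for f :: "'a weyl"
  proof (induction f rule: weyl_induct)
    case (add c x f)
    have "weyl_elem x \<in> complex_vector.span (range weyl_elem)" by (simp add: complex_vector.span_base)
    then show ?case
      using add by (auto simp: completion_of_simps weyl_elem_def[symmetric]
          intro!: complex_vector.span_add complex_vector.span_scale)
  qed (simp add: completion_of_simps complex_vector.span_zero)
  then show "range completion_of \<subseteq> complex_vector.span (range (weyl_elem :: 'a \<Rightarrow> _))" by auto
qed

lemma ccr_generated: "closure (complex_vector.span (range (weyl_elem :: 'h::complex_inner \<Rightarrow> 'h ccr))) = UNIV"
proof -
  have "x \<in> closure (range completion_of)" for x :: "'h ccr"
  proof (subst closure_approachable, intro allI impI)
    fix e :: real assume "e > 0"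
    then obtain a where "norm (x - completion_of a) < e" by (rule completion_of_dense)
    then show "\<exists>y\<in>range completion_of. dist y x < e" by (auto simp: dist_norm norm_minus_commute)
  qed
  then show ?thesis by (auto simp: span_weyl_elem)
qed

text \<open>
  \<^typ>\<open>'h ccr\<close> is universal among C*-algebras with a family satisfying the Weyl relations.
  Continuity is automatic for *-homomorphisms between C*-algebras; it is spelled out so that
  uniqueness is immediate from \<open>ccr_generated\<close>.
\<close>

theorem ccr_universal:
  fixes V :: "'h::complex_inner \<Rightarrow> 'a::cstar_algebra"
  assumes V: "weyl_relations V"
  shows "\<exists>!\<pi> :: 'h ccr \<Rightarrow> 'a. star_hom \<pi> \<and> continuous_on UNIV \<pi> \<and> (\<forall>x. \<pi> (weyl_elem x) = V x)"
proof (rule ex_ex1I)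
  let ?\<phi> = "wext V"
  have h: "?\<phi> (f * g) = ?\<phi> f * ?\<phi> g" "?\<phi> (star f) = star (?\<phi> f)" "?\<phi> (f - g) = ?\<phi> f - ?\<phi> g" for f g
  proof -
    show "?\<phi> (f * g) = ?\<phi> f * ?\<phi> g" "?\<phi> (star f) = star (?\<phi> f)"
      using wext_star_hom[OF V] by (auto simp: star_hom_def)
    show "?\<phi> (f - g) = ?\<phi> f - ?\<phi> g" using wext_add[of V "f - g" g] by simp
  qed
  have C: "Cauchy (\<lambda>n. ?\<phi> (X n))" if "Cauchy X" for X
  proof (rule Cauchy_dominated[OF that that, of 1])
    fix m n
    have "norm (?\<phi> (X m) - ?\<phi> (X n)) \<le> norm (X m - X n)"
      using star_hom_norm_wext_le[OF V, of "X m - X n"] by (simp only: h(3))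
    also have "\<dots> \<le> 1 * (norm (X m - X n) + norm (X m - X n))" by simp
    finally show "norm (?\<phi> (X m) - ?\<phi> (X n)) \<le> \<dots>" .
  qed simp
  define \<pi> where "\<pi> x = lim (\<lambda>n. ?\<phi> (rep_completion x n))" for x
  have lim: "(\<lambda>n. ?\<phi> (X n)) \<longlonglongrightarrow> \<pi> (abs_completion X)" if X: "Cauchy X" for X
  proof -
    let ?Y = "rep_completion (abs_completion X)"
    have e: "cauchy_eq ?Y X"
      by (rule rep_abs_rsp_left[OF Quotient3_completion]) (simp add: X)
    then have Y: "Cauchy ?Y" and l: "(\<lambda>n. norm (?Y n - X n)) \<longlonglongrightarrow> 0"
      by (auto simp: cauchy_eq_def tendsto_norm_zero_iff)
    have "(\<lambda>n. ?\<phi> (?Y n)) \<longlonglongrightarrow> \<pi> (abs_completion X)"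
      using Cauchy_convergent[OF C[OF Y]] by (simp add: \<pi>_def convergent_LIMSEQ_iff)
    moreover have "(\<lambda>n. ?\<phi> (?Y n) - ?\<phi> (X n)) \<longlonglongrightarrow> 0"
      by (rule Lim_null_comparison[OF _ l])
        (auto intro!: always_eventually star_hom_norm_wext_le[OF V] simp flip: h(3))
    ultimately show ?thesis using tendsto_diff by fastforce
  qed
  have eqI: "\<pi> (abs_completion X) = l" if "Cauchy X" "(\<lambda>n. ?\<phi> (X n)) \<longlonglongrightarrow> l" for X l
    using LIMSEQ_unique[OF lim[OF that(1)] that(2)] .
  have add: "\<pi> (a + b) = \<pi> a + \<pi> b" and mult: "\<pi> (a * b) = \<pi> a * \<pi> b" for a b
  proof -
    obtain X Y where X: "Cauchy X" "a = abs_completion X" and Y: "Cauchy Y" "b = abs_completion Y"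
      by (metis completion_cases)
    show "\<pi> (a + b) = \<pi> a + \<pi> b"
      using X Y by (auto simp: plus_completion.abs_eq intro!: eqI Cauchy_intros tendsto_add lim)
    show "\<pi> (a * b) = \<pi> a * \<pi> b"
      using X Y by (auto simp: times_completion.abs_eq h intro!: eqI Cauchy_intros tendsto_mult lim)
  qed
  have scale: "\<pi> (c *\<^sub>C a) = c *\<^sub>C \<pi> a" and star: "\<pi> (star a) = star (\<pi> a)"
    and le: "norm (\<pi> a) \<le> norm a" for c a
  proof -
    obtain X where X: "Cauchy X" "a = abs_completion X" by (metis completion_cases)
    have l: "(\<lambda>n. norm (?\<phi> (X n) - \<pi> a)) \<longlonglongrightarrow> 0"
      using lim[OF X(1)] by (simp add: X(2) LIM_zero tendsto_norm_zero)
    have "(\<lambda>n. norm (c *\<^sub>C ?\<phi> (X n) - c *\<^sub>C \<pi> a)) \<longlonglongrightarrow> 0"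
      using tendsto_mult_right_zero[OF l, of "cmod c"]
      by (simp flip: complex_vector.scale_right_diff_distrib)
    then have "(\<lambda>n. c *\<^sub>C ?\<phi> (X n)) \<longlonglongrightarrow> c *\<^sub>C \<pi> a"
      by (rule LIM_zero_cancel[OF tendsto_norm_zero_cancel])
    then show "\<pi> (c *\<^sub>C a) = c *\<^sub>C \<pi> a"
      using X by (auto simp: scaleC_completion.abs_eq intro!: eqI Cauchy_intros)
    have "(\<lambda>n. norm (star (?\<phi> (X n)) - star (\<pi> a))) \<longlonglongrightarrow> 0"
      using l by (simp flip: star_diff)
    then have "(\<lambda>n. star (?\<phi> (X n))) \<longlonglongrightarrow> star (\<pi> a)"
      by (rule LIM_zero_cancel[OF tendsto_norm_zero_cancel])
    then show "\<pi> (star a) = star (\<pi> a)"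
      using X by (auto simp: star_completion.abs_eq h intro!: eqI Cauchy_intros)
    have "(\<lambda>n. norm (X n)) \<longlonglongrightarrow> norm a"
      using Cauchy_norm_LIMSEQ[OF X(1)] X by (simp add: norm_completion.abs_eq)
    with tendsto_norm[OF lim[OF X(1)]] show "norm (\<pi> a) \<le> norm a"
      unfolding X(2) by (rule LIMSEQ_le) (auto intro: star_hom_norm_wext_le[OF V])
  qed
  have "\<pi> (weyl_elem x) = V x" for x
    unfolding weyl_elem_def completion_of.abs_eq by (rule eqI) auto
  moreover have "continuous_on UNIV \<pi>"
  proof -
    have d: "\<pi> a - \<pi> b = \<pi> (a - b)" for a b using add[of "a - b" b] by simp
    have "1-lipschitz_on UNIV \<pi>"
      by (rule lipschitz_onI) (auto simp: dist_norm d le)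
    then show ?thesis by (rule lipschitz_on_continuous_on)
  qed
  ultimately show "\<exists>\<pi> :: 'h ccr \<Rightarrow> 'a. star_hom \<pi> \<and> continuous_on UNIV \<pi> \<and> (\<forall>x. \<pi> (weyl_elem x) = V x)"
    using add mult scale star by (auto simp: star_hom_def intro!: exI[of _ \<pi>])
next
  fix \<pi> \<rho> :: "'h ccr \<Rightarrow> 'a"
  assume p: "star_hom \<pi> \<and> continuous_on UNIV \<pi> \<and> (\<forall>x. \<pi> (weyl_elem x) = V x)"
    and r: "star_hom \<rho> \<and> continuous_on UNIV \<rho> \<and> (\<forall>x. \<rho> (weyl_elem x) = V x)"
  let ?E = "{a. \<pi> a = \<rho> a}"
  have z: "\<pi> 0 = 0" "\<rho> 0 = 0"
    using p r unfolding star_hom_def by (metis scaleC_zero_left)+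
  have "complex_vector.subspace ?E"
    using p r z by (auto simp: complex_vector.subspace_def star_hom_def)
  then have "complex_vector.span (range weyl_elem) \<subseteq> ?E"
    using p r by (intro complex_vector.span_minimal) auto
  moreover have "closed ?E"
    using p r by (intro closed_Collect_eq) auto
  ultimately have "closure (complex_vector.span (range weyl_elem)) \<subseteq> ?E"
    by (rule closure_minimal)
  then show "\<pi> = \<rho>" unfolding ccr_generated by auto
qed

definition ccr_map :: "('h::complex_inner \<Rightarrow> 'g::complex_inner) \<Rightarrow> 'h ccr \<Rightarrow> 'g ccr" where
  "ccr_map T = (THE \<pi>. star_hom \<pi> \<and> continuous_on UNIV \<pi> \<and> (\<forall>x. \<pi> (weyl_elem x) = weyl_elem (T x)))"

lemma ccr_map:
  assumes "\<And>x y. T (x + y) = T x + T y" and "\<And>x y. symplectic (T x) (T y) = symplectic x y"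
  shows "star_hom (ccr_map T)" "continuous_on UNIV (ccr_map T)"
    "ccr_map T (weyl_elem x) = weyl_elem (T x)"
proof -
  have "T 0 = 0" using assms(1)[of 0 0] by simp
  then have "T (- x) = - T x" for x
    using assms(1)[of x "- x"] by (simp add: eq_neg_iff_add_eq_0 add.commute)
  then have "weyl_relations (\<lambda>x. weyl_elem (T x))"
    using weyl_relations_elem assms unfolding weyl_relations_def by metis
  from theI'[OF ccr_universal[OF this]]
  show "star_hom (ccr_map T)" "continuous_on UNIV (ccr_map T)"
    "ccr_map T (weyl_elem x) = weyl_elem (T x)"
    unfolding ccr_map_def by auto
qed


section \<open>States\<close>

definition cstar_subalgebra :: "'a::cstar_algebra set \<Rightarrow> bool" where
  "cstar_subalgebra B \<longleftrightarrow> complex_vector.subspace B \<and> (\<forall>a\<in>B. \<forall>b\<in>B. a * b \<in> B) \<and>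
     (\<forall>a\<in>B. star a \<in> B) \<and> closed B"

definition cstar_generated :: "'a::cstar_algebra set \<Rightarrow> 'a set" where
  "cstar_generated S = \<Inter>{B. cstar_subalgebra B \<and> S \<subseteq> B}"

text \<open>
  A state is a unital positive linear functional; boundedness is automatic.
  A state on a C*-subalgebra \<open>B\<close> containing the unit is represented by the function extending it
  by \<open>0\<close> outside \<open>B\<close>, so that equality of states is equality of functions.
\<close>

definition states_on :: "'a::cstar_algebra set \<Rightarrow> ('a \<Rightarrow> complex) set" where
  "states_on B = {\<omega>. (\<forall>a\<in>B. \<forall>b\<in>B. \<omega> (a + b) = \<omega> a + \<omega> b) \<and> (\<forall>c. \<forall>a\<in>B. \<omega> (c *\<^sub>C a) = c * \<omega> a) \<and>
     (\<forall>a\<in>B. \<omega> (star a * a) \<in> \<real>\<^sub>\<ge>\<^sub>0) \<and> \<omega> 1 = 1 \<and> (\<forall>a. a \<notin> B \<longrightarrow> \<omega> a = 0)}"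

text \<open>
  The library's \<^const>\<open>extreme_point_of\<close> needs a type of class \<^class>\<open>real_vector\<close>, which the
  function type is not; this is the same notion for pointwise convex combinations.
\<close>

definition extreme_functional :: "('a \<Rightarrow> complex) \<Rightarrow> ('a \<Rightarrow> complex) set \<Rightarrow> bool" where
  "extreme_functional \<omega> S \<longleftrightarrow> \<omega> \<in> S \<and>
     (\<forall>\<psi>\<in>S. \<forall>\<psi>'\<in>S. \<forall>t::real. 0 < t \<and> t < 1 \<and>
        \<omega> = (\<lambda>a. complex_of_real (1 - t) * \<psi> a + complex_of_real t * \<psi>' a) \<longrightarrow> \<psi> = \<psi>')"


section \<open>Rotatable states and product states\<close>

definition orthonormal_basis :: "(int \<Rightarrow> 'h::complex_hilbert) \<Rightarrow> bool" where
  "orthonormal_basis e \<longleftrightarrow> (\<forall>j k. cinner (e j) (e k) = (if j = k then 1 else 0)) \<and>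
     closure (complex_vector.span (range e)) = UNIV"

definition B0 :: "(int \<Rightarrow> 'h::complex_hilbert) \<Rightarrow> 'h ccr set" where
  "B0 e = cstar_generated (weyl_elem ` complex_vector.span (range e))"

definition unitary :: "('h::complex_hilbert \<Rightarrow> 'h) \<Rightarrow> bool" where
  "unitary U \<longleftrightarrow> Vector_Spaces.linear scaleC scaleC U \<and> (\<forall>x y. cinner (U x) (U y) = cinner x y) \<and> surj U"

definition UZ :: "(int \<Rightarrow> 'h::complex_hilbert) \<Rightarrow> ('h \<Rightarrow> 'h) set" where
  "UZ e = {U. unitary U \<and> (\<exists>N>0. \<forall>i. \<bar>i\<bar> > N \<longrightarrow> U (e i) = e i)}"

definition OZ :: "(int \<Rightarrow> 'h::complex_hilbert) \<Rightarrow> ('h \<Rightarrow> 'h) set" where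
  "OZ e = {R \<in> UZ e. \<forall>i j. cinner (R (e i)) (e j) \<in> \<real>}"

text \<open>
  For \<open>U \<in> UZ e\<close> the automorphism \<open>\<rho>\<^sub>U\<close> of \<^term>\<open>B0 e\<close> is the restriction of \<^term>\<open>ccr_map U\<close>.
\<close>

definition rotatable_states :: "(int \<Rightarrow> 'h::complex_hilbert) \<Rightarrow> ('h ccr \<Rightarrow> complex) set" where
  "rotatable_states e = {\<omega> \<in> states_on (B0 e). \<forall>R\<in>OZ e. \<forall>a\<in>B0 e. \<omega> (ccr_map R a) = \<omega> a}"

lemma ccr_map_unitary:
  assumes "unitary U"
  shows "star_hom (ccr_map U)" "continuous_on UNIV (ccr_map U)"
    "ccr_map U (weyl_elem x) = weyl_elem (U x)"
proof -
  interpret Vector_Spaces.linear scaleC scaleC U using assms by (simp add: unitary_def)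
  have "U (x + y) = U x + U y" "symplectic (U x) (U y) = symplectic x y" for x y
    using assms by (auto simp: unitary_def symplectic_def add)
  then show "star_hom (ccr_map U)" "continuous_on UNIV (ccr_map U)"
    "ccr_map U (weyl_elem x) = weyl_elem (U x)"
    by (auto intro: ccr_map)
qed

definition ccr_embed :: "(int \<Rightarrow> 'h::complex_hilbert) \<Rightarrow> int \<Rightarrow> complex ccr \<Rightarrow> 'h ccr" where
  "ccr_embed e k = ccr_map (\<lambda>z. z *\<^sub>C e k)"

lemma ccr_embed:
  assumes "orthonormal_basis e"
  shows "star_hom (ccr_embed e k)" "continuous_on UNIV (ccr_embed e k)"
    "ccr_embed e k (weyl_elem z) = weyl_elem (z *\<^sub>C e k)"
proof -
  have "cinner (z *\<^sub>C e k) (w *\<^sub>C e k) = z * cnj w" for z w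
    using assms by (simp add: orthonormal_basis_def cinner_scaleC_left
        cinner_scaleC_right)
  then have "symplectic (z *\<^sub>C e k) (w *\<^sub>C e k) = symplectic z w" for z w
    by (simp add: symplectic_def cinner_complex_def)
  then show "star_hom (ccr_embed e k)" "continuous_on UNIV (ccr_embed e k)"
    "ccr_embed e k (weyl_elem z) = weyl_elem (z *\<^sub>C e k)"
    unfolding ccr_embed_def by (auto intro!: ccr_map scaleC_add_left)
qed

text \<open>
  At most one state of \<^term>\<open>B0 e\<close> is the product state of \<open>\<phi>\<close>, because the products
  \<open>i\<^sub>k\<^sub>1 (a\<^sub>1) \<cdots> i\<^sub>k\<^sub>n (a\<^sub>n)\<close> with distinct indices span a dense subspace.
\<close>

definition is_product_state ::
    "(int \<Rightarrow> 'h::complex_hilbert) \<Rightarrow> (complex ccr \<Rightarrow> complex) \<Rightarrow> ('h ccr \<Rightarrow> complex) \<Rightarrow> bool" where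
  "is_product_state e \<phi> \<omega> \<longleftrightarrow> \<omega> \<in> states_on (B0 e) \<and>
     (\<forall>ks a. distinct ks \<longrightarrow>
        \<omega> (\<Prod>k\<leftarrow>ks. ccr_embed e k (a k)) = (\<Prod>k\<leftarrow>ks. \<phi> (a k)))"

end

theory Submission
  imports Defs
begin

text \<open>
  Compress \<open>\<omega>\<close> by \<open>d\<^sub>n = 1 + (s/2) W (z e\<^sub>n)\<close> with \<open>\<bar>s\<bar> = 1\<close> and let \<open>n \<rightarrow> \<infinity>\<close>. On \<open>W x\<close>,
  \<open>x \<in> \<H>\<^sub>0\<close>, the value \<open>\<omega> (d\<^sub>n\<^sup>* W x d\<^sub>n)\<close> is eventually constant, because \<open>\<omega>\<close> is invariant under the
  reflection in \<open>e\<^sub>m - e\<^sub>n\<close>, which swaps \<open>e\<^sub>m\<close> and \<open>e\<^sub>n\<close>. So a limit functional exists; it is positive, and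
  rotatable because every \<open>R \<in> \<bbbO>\<^sub>\<int>\<close> fixes \<open>d\<^sub>n\<close> for large \<open>n\<close>. The limits for \<open>s\<close> and \<open>-s\<close> add up
  to \<open>(5/2) \<omega>\<close>, so both are multiples of \<open>\<omega>\<close> when \<open>\<omega>\<close> is extreme. Evaluating them for \<open>s = 1\<close> and
  \<open>s = \<i>\<close> gives \<open>\<omega> (W (x + z e\<^sub>k)) = \<omega> (W x) \<omega> (W (z e\<^sub>0))\<close> whenever \<open>x \<bottom> e\<^sub>k\<close>, which is the product
  property on Weyl elements; it extends by linearity and continuity.
\<close>


section \<open>Bounded positive functionals\<close>

lemma bounded_linear_scaleC: "bounded_linear (\<lambda>x::'a::pre_cstar_algebra. c *\<^sub>C x)"
  by (rule bounded_linear_intro[of _ "cmod c"])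
    (simp_all add: scaleC_add_right scaleR_scaleC mult.commute)

lemma bounded_linear_star: "bounded_linear (star :: 'a::pre_cstar_algebra \<Rightarrow> 'a)"
  by (rule bounded_linear_intro[of _ 1]) (simp_all add: star_add star_scaleC scaleR_scaleC)

lemmas tendsto_scaleC [tendsto_intros] = bounded_linear.tendsto[OF bounded_linear_scaleC]
lemmas tendsto_star [tendsto_intros] = bounded_linear.tendsto[OF bounded_linear_star]

section \<open>C*-subalgebras, their closures and preimages\<close>

lemma cstar_subalgebraD:
  assumes "cstar_subalgebra B"
  shows "0 \<in> B" "a \<in> B \<Longrightarrow> b \<in> B \<Longrightarrow> a + b \<in> B" "a \<in> B \<Longrightarrow> c *\<^sub>C a \<in> B"
    "a \<in> B \<Longrightarrow> b \<in> B \<Longrightarrow> a - b \<in> B" "a \<in> B \<Longrightarrow> b \<in> B \<Longrightarrow> a * b \<in> B"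
    "a \<in> B \<Longrightarrow> star a \<in> B" "closed B"
  using assms unfolding cstar_subalgebra_def
  by (auto intro: complex_vector.subspace_0 complex_vector.subspace_add
      complex_vector.subspace_scale complex_vector.subspace_diff)

lemma cstar_subalgebra_UNIV: "cstar_subalgebra UNIV"
  by (simp add: cstar_subalgebra_def)

lemma cstar_subalgebra_Inter:
  assumes "\<And>B. B \<in> \<B> \<Longrightarrow> cstar_subalgebra B"
  shows "cstar_subalgebra (\<Inter>\<B>)"
  using assms unfolding cstar_subalgebra_def
  by (simp add: complex_vector.subspace_def closed_Inter)

lemma cstar_subalgebra_closure:
  fixes S :: "'a::cstar_algebra set"
  assumes "complex_vector.subspace S"
    and mult: "\<And>a b. a \<in> S \<Longrightarrow> b \<in> S \<Longrightarrow> a * b \<in> S"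
    and star: "\<And>a. a \<in> S \<Longrightarrow> star a \<in> S"
  shows "cstar_subalgebra (closure S)"
proof -
  have "0 \<in> closure S"
    using complex_vector.subspace_0[OF assms(1)] closure_subset by blast
  moreover have "a + b \<in> closure S" "a * b \<in> closure S"
    if "a \<in> closure S" "b \<in> closure S" for a b
  proof -
    from that obtain X Y where X: "\<forall>n. X n \<in> S" "X \<longlonglongrightarrow> a" and Y: "\<forall>n. Y n \<in> S" "Y \<longlonglongrightarrow> b"
      unfolding closure_sequential by auto
    show "a + b \<in> closure S"
      unfolding closure_sequential using X Y
      by (intro exI[of _ "\<lambda>n. X n + Y n"])
        (auto intro: tendsto_add complex_vector.subspace_add[OF assms(1)])
    show "a * b \<in> closure S"
      unfolding closure_sequential using X Y
      by (intro exI[of _ "\<lambda>n. X n * Y n"]) (auto intro: tendsto_mult mult)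
  qed
  moreover have "c *\<^sub>C a \<in> closure S" "star a \<in> closure S" if "a \<in> closure S" for a c
  proof -
    from that obtain X where X: "\<forall>n. X n \<in> S" "X \<longlonglongrightarrow> a"
      unfolding closure_sequential by auto
    show "c *\<^sub>C a \<in> closure S"
      unfolding closure_sequential using X
      by (intro exI[of _ "\<lambda>n. c *\<^sub>C X n"])
        (auto intro: tendsto_scaleC complex_vector.subspace_scale[OF assms(1)])
    show "star a \<in> closure S"
      unfolding closure_sequential using X
      by (intro exI[of _ "\<lambda>n. star (X n)"]) (auto intro: tendsto_star star)
  qed
  ultimately show ?thesis
    by (auto simp: cstar_subalgebra_def complex_vector.subspace_def)
qed

text \<open>Reduces the claim that \<open>\<pi>\<close> maps a generated algebra into
  \<open>B\<close> to a check on the generators.\<close>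

lemma cstar_subalgebra_vimage:
  assumes "star_hom \<pi>" "continuous_on UNIV \<pi>" "cstar_subalgebra B"
  shows "cstar_subalgebra (\<pi> -` B)"
proof -
  have "\<pi> 0 = 0" using assms(1) unfolding star_hom_def by (metis scaleC_zero_left)
  moreover have "closed (\<pi> -` B)"
    using assms(2) cstar_subalgebraD(7)[OF assms(3)]
    by (simp add: continuous_closed_vimage continuous_on_eq_continuous_at)
  ultimately show ?thesis
    using assms(1,3) by (simp add: cstar_subalgebra_def complex_vector.subspace_def star_hom_def)
qed

text \<open>Consecutive coefficients have ratio (1/2 - n) / (n + 1), of modulus at most 1. Hence the
  binomial series of the square root is dominated by the geometric series.\<close>

lemma gbinomial_half_le_1: "\<bar>(1/2::real) gchoose n\<bar> \<le> 1"
proof (induction n)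
  case (Suc n)
  have "(1/2::real) gchoose Suc n = (1/2 gchoose n) * ((1/2 - real n) / real (Suc n))"
    using gbinomial_absorption'[of "Suc n" "1/2::real"]
      gbinomial_mult_1[of "1/2::real" n] by (simp add: field_simps)
  moreover have "\<bar>(1/2 - real n) / real (Suc n)\<bar> \<le> 1" by (simp add: field_simps abs_le_iff)
  ultimately show ?case using Suc by (metis abs_mult abs_ge_zero mult_le_one)
qed simp

text \<open>The root is the binomial series of (1 + x)^(1/2) at x = -h, absolutely convergent
  because \<open>norm h < 1\<close>. Its partial sums are self-adjoint elements of the closed set
  \<open>B\<close>, and so is its sum.\<close>

lemma cstar_sqrt_one_minus:
  fixes h :: "'a::cstar_algebra"
  assumes B: "cstar_subalgebra B" "1 \<in> B" and h: "h \<in> B" "star h = h" "norm h < 1"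
  obtains s where "s \<in> B" "star s = s" "s * s = 1 - h"
proof -
  define t where "t n = ((1/2::real) gchoose n) *\<^sub>R (- h) ^ n" for n
  have "norm (t n) \<le> norm h ^ n" for n
    unfolding t_def
    using mult_mono[OF gbinomial_half_le_1[of n] norm_power_ineq[of "- h" n]] by simp
  then have sum: "summable (\<lambda>n. norm (t n))"
    using h(3) by (intro summable_comparison_test'[OF summable_geometric[of "norm h"], of 0]) auto
  then have t: "t sums suminf t" by (rule summable_sums[OF summable_norm_cancel])
  have g: "- h \<in> B" "star (- h) = - h"
    using cstar_subalgebraD(4)[OF B(1) cstar_subalgebraD(1)[OF B(1)] h(1)] h(2)
    by (simp_all add: star_minus)
  have "(- h) ^ n \<in> B \<and> star ((- h) ^ n) = (- h) ^ n" for n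
  proof (induction n)
    case (Suc n)
    have "(- h) ^ Suc n = (- h) ^ n * - h" by (rule power_Suc2)
    then show ?case
      using Suc g cstar_subalgebraD(5)[OF B(1)] by (metis power_Suc star_mult)
  qed (simp add: B)
  then have tB: "t n \<in> B" "star (t n) = t n" for n
    by (auto simp: t_def scaleR_scaleC star_scaleC cstar_subalgebraD(3)[OF B(1)])
  have "(\<Sum>i<n. t i) \<in> B" for n
    by (induction n) (auto simp: tB cstar_subalgebraD[OF B(1)])
  then have "suminf t \<in> B"
    by (rule closed_sequentially[OF cstar_subalgebraD(7)[OF B(1)]]) (rule t[unfolded sums_def])
  moreover have "star (suminf t) = suminf t"
    using bounded_linear.sums[OF bounded_linear_star t] t by (simp add: tB sums_unique2)
  moreover have "suminf t * suminf t = 1 - h"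
  proof -
    \<comment> \<open>By Vandermonde's identity the coefficients of the squared series are those of
      (1 + x)^1.\<close>
    have "(\<Sum>i\<le>k. t i * t (k - i)) = (1 gchoose k) *\<^sub>R (- h) ^ k" for k
    proof -
      have "(\<Sum>i\<le>k. t i * t (k - i)) =
          (\<Sum>i\<le>k. ((1/2 gchoose i) * (1/2 gchoose (k - i))) *\<^sub>R (- h) ^ k)"
        by (intro sum.cong) (auto simp: t_def simp flip: power_add)
      then show ?thesis
        using gbinomial_Vandermonde[of "1/2::real" "1/2" k] by (simp add: atLeast0AtMost flip: scaleR_left.sum)
    qed
    with Cauchy_product_sums[OF sum sum]
    have "(\<lambda>k. (1 gchoose k) *\<^sub>R (- h) ^ k) sums (suminf t * suminf t)" by simp
    \<comment> \<open>Only the terms 1 (k = 0) and -h (k = 1) survive.\<close>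
    moreover have "((1::real) gchoose k) *\<^sub>R (- h) ^ k = 0" if "k \<notin> {0, 1}" for k
      using gbinomial_of_nat_symmetric binomial_gbinomial[of 1 k, where 'a = real] that
      by (auto simp: binomial_eq_0)
    then have "(\<lambda>k. (1 gchoose k) *\<^sub>R (- h) ^ k) sums
        (\<Sum>k\<in>{0, 1}. (1 gchoose k) *\<^sub>R (- h) ^ k)"
      by (intro sums_finite) auto
    ultimately show ?thesis by (simp add: sums_unique2)
  qed
  ultimately show thesis by (rule that)
qed

section \<open>States are Hermitian, bounded and continuous\<close>

lemma states_onD:
  assumes "\<omega> \<in> states_on B"
  shows "a \<in> B \<Longrightarrow> b \<in> B \<Longrightarrow> \<omega> (a + b) = \<omega> a + \<omega> b" "a \<in> B \<Longrightarrow> \<omega> (c *\<^sub>C a) = c * \<omega> a"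
    "a \<in> B \<Longrightarrow> \<omega> (star a * a) \<in> \<real>\<^sub>\<ge>\<^sub>0" "\<omega> 1 = 1" "a \<notin> B \<Longrightarrow> \<omega> a = 0"
  using assms by (auto simp: states_on_def)

context
  fixes B :: "'a::cstar_algebra set" and \<omega> :: "'a \<Rightarrow> complex"
  assumes B: "cstar_subalgebra B" "1 \<in> B" and \<omega>: "\<omega> \<in> states_on B"
begin

lemma state_diff: "a \<in> B \<Longrightarrow> b \<in> B \<Longrightarrow> \<omega> (a - b) = \<omega> a - \<omega> b"
  using states_onD(1)[OF \<omega>, of "a - b" b] cstar_subalgebraD[OF B(1)] by simp

text \<open>Positivity of this value for suitable scalars drives the next two lemmas:
  \<open>l = 1\<close> and \<open>l = \<i>\<close> give the Hermitian property,
  \<open>l = - \<omega> a\<close> the Cauchy-Schwarz inequality.\<close>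

lemma state_shift_square:
  assumes a: "a \<in> B"
  shows "\<omega> (star (l *\<^sub>C 1 + a) * (l *\<^sub>C 1 + a)) =
    cnj l * l + cnj l * \<omega> a + l * \<omega> (star a) + \<omega> (star a * a)"
proof -
  note in_B = cstar_subalgebraD[OF B(1)]
  have "star (l *\<^sub>C 1 + a) * (l *\<^sub>C 1 + a) =
      (cnj l * l) *\<^sub>C 1 + (cnj l *\<^sub>C a + (l *\<^sub>C star a + star a * a))"
    by (simp add: star_add star_scaleC ring_distribs scaleC_add_right mult.commute add.assoc)
  then show ?thesis using a B(2) by (simp add: states_onD[OF \<omega>] in_B)
qed

lemma state_star:
  assumes a: "a \<in> B" shows "\<omega> (star a) = cnj (\<omega> a)"
proof -
  have "\<omega> (star (l *\<^sub>C 1 + a) * (l *\<^sub>C 1 + a)) \<in> \<real>\<^sub>\<ge>\<^sub>0" for l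
    using a B by (intro states_onD(3)[OF \<omega>] cstar_subalgebraD)
  \<comment> \<open>All these values are real. For \<open>l = 1\<close> this makes the imaginary
    parts of \<open>\<omega> a\<close> and \<open>\<omega> (star a)\<close> opposite, for
    \<open>l = \<i>\<close> it makes their real parts equal.\<close>
  from this[of 1] this[of \<i>] states_onD(3)[OF \<omega> a] show ?thesis
    unfolding state_shift_square[OF a]
    by (auto simp: complex_nonneg_Reals_iff complex_eq_iff)
qed

lemma state_Cauchy_Schwarz:
  assumes a: "a \<in> B" shows "(cmod (\<omega> a))\<^sup>2 \<le> Re (\<omega> (star a * a))"
proof -
  let ?l = "- \<omega> a"
  have "\<omega> (star (?l *\<^sub>C 1 + a) * (?l *\<^sub>C 1 + a)) \<in> \<real>\<^sub>\<ge>\<^sub>0"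
    using a B by (intro states_onD(3)[OF \<omega>] cstar_subalgebraD)
  then have "0 \<le> Re (\<omega> (star a * a) - \<omega> a * cnj (\<omega> a))"
    unfolding state_shift_square[OF a] state_star[OF a]
    by (simp add: complex_nonneg_Reals_iff algebra_simps)
  then show ?thesis by (simp flip: complex_norm_square of_real_power)
qed

text \<open>If r exceeds the square of \<open>norm a\<close>, then 1 - (1 / r)
  \<open>star a * a\<close> is the square of a self-adjoint element, so
  \<open>\<omega> (star a * a)\<close> is at most r. Cauchy-Schwarz and letting r decrease give the
  bound.\<close>

lemma state_norm_le:
  assumes a: "a \<in> B" shows "cmod (\<omega> a) \<le> norm a"
proof -
  note in_B = cstar_subalgebraD[OF B(1)]
  have "(cmod (\<omega> a))\<^sup>2 \<le> (norm a)\<^sup>2 + \<epsilon>" if "\<epsilon> > 0" for \<epsilon>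
  proof -
    \<comment> \<open>The surplus \<epsilon> makes \<open>norm h\<close> strictly less than 1, and
      keeps \<open>r\<close> positive even when \<open>a = 0\<close>.\<close>
    define r where "r = (norm a)\<^sup>2 + \<epsilon>"
    have r: "r > 0" using that by (simp add: r_def add_nonneg_pos)
    define h where "h = complex_of_real (1 / r) *\<^sub>C (star a * a)"
    have "norm h = (norm a)\<^sup>2 / r" using r by (simp add: h_def cstar_identity norm_divide)
    then have "norm h < 1" using r that by (simp add: r_def)
    moreover have "h \<in> B" "star h = h" by (auto simp: h_def a in_B star_scaleC star_mult)
    ultimately obtain s where s: "s \<in> B" "star s = s" "s * s = 1 - h"
      using cstar_sqrt_one_minus[OF B] by blast
    then have "\<omega> (1 - h) \<in> \<real>\<^sub>\<ge>\<^sub>0" using states_onD(3)[OF \<omega> s(1)] by simp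
    then have "Re (\<omega> h) \<le> 1"
      using state_diff[OF B(2) \<open>h \<in> B\<close>] by (simp add: states_onD(4)[OF \<omega>] complex_nonneg_Reals_iff)
    moreover have "\<omega> h = \<omega> (star a * a) / complex_of_real r"
      by (simp add: h_def states_onD(2)[OF \<omega>] a in_B)
    ultimately have "Re (\<omega> (star a * a)) \<le> r" using r by (simp add: field_simps)
    then show ?thesis using state_Cauchy_Schwarz[OF a] by (simp add: r_def)
  qed
  then have "(cmod (\<omega> a))\<^sup>2 \<le> (norm a)\<^sup>2" by (rule field_le_epsilon)
  then show ?thesis by (rule power2_le_imp_le) simp
qed

lemma continuous_on_state: "continuous_on B \<omega>"
proof -
  have "1-lipschitz_on B \<omega>"
    by (rule lipschitz_onI)
      (auto simp: dist_norm cstar_subalgebraD[OF B(1)] state_norm_le simp flip: state_diff)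
  then show ?thesis by (rule lipschitz_on_continuous_on)
qed

end

text \<open>The set of agreement is a closed subspace. This is the tool for checking identities
  between functionals on Weyl elements only.\<close>

lemma functional_eq_on_closure_span:
  fixes f g :: "'a::cstar_algebra \<Rightarrow> complex"
  assumes B: "cstar_subalgebra B" and S: "S \<subseteq> B" "B \<subseteq> closure (complex_vector.span S)"
    and f: "continuous_on B f" "\<And>a b. a \<in> B \<Longrightarrow> b \<in> B \<Longrightarrow> f (a + b) = f a + f b"
      "\<And>c a. a \<in> B \<Longrightarrow> f (c *\<^sub>C a) = c * f a"
    and g: "continuous_on B g" "\<And>a b. a \<in> B \<Longrightarrow> b \<in> B \<Longrightarrow> g (a + b) = g a + g b"
      "\<And>c a. a \<in> B \<Longrightarrow> g (c *\<^sub>C a) = c * g a"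
    and eq: "\<And>a. a \<in> S \<Longrightarrow> f a = g a" and a: "a \<in> B"
  shows "f a = g a"
proof -
  let ?E = "{a \<in> B. f a - g a = 0}"
  note in_B = cstar_subalgebraD[OF B]
  have "f 0 = 0" "g 0 = 0" using f(3)[of 0 0] g(3)[of 0 0] in_B(1) by auto
  then have "complex_vector.subspace ?E"
    unfolding complex_vector.subspace_def by (simp add: in_B f g)
  then have "complex_vector.span S \<subseteq> ?E"
    using S(1) eq by (intro complex_vector.span_minimal) auto
  moreover have "closed ?E"
    by (intro continuous_closed_preimage_constant continuous_on_diff f g in_B)
  ultimately show ?thesis using a S(2) closure_minimal[of "complex_vector.span S" ?E] by auto
qed

text \<open>A three-epsilon argument: the bound \<open>K\<close> is uniform in \<open>n\<close>, so
  convergence on a dense set extends to its closure.\<close>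

lemma closed_convergent:
  fixes f :: "nat \<Rightarrow> 'a::cstar_algebra \<Rightarrow> complex"
  assumes B: "cstar_subalgebra B"
    and diff: "\<And>n a b. a \<in> B \<Longrightarrow> b \<in> B \<Longrightarrow> f n (a - b) = f n a - f n b"
    and bound: "\<And>n a. a \<in> B \<Longrightarrow> cmod (f n a) \<le> K * norm a" and K: "K > 0"
  shows "closed {a \<in> B. convergent (\<lambda>n. f n a)}"
  unfolding closed_sequential_limits
proof (intro allI impI)
  fix X l
  assume "(\<forall>k. X k \<in> {a \<in> B. convergent (\<lambda>n. f n a)}) \<and> X \<longlonglongrightarrow> l"
  then have X: "\<And>k. X k \<in> B" "\<And>k. convergent (\<lambda>n. f n (X k))" "X \<longlonglongrightarrow> l" by auto
  have l: "l \<in> B" by (rule closed_sequentially[OF cstar_subalgebraD(7)[OF B] X(1) X(3)])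
  have "Cauchy (\<lambda>n. f n l)"
  proof (rule CauchyI)
    fix \<epsilon> :: real assume \<epsilon>: "\<epsilon> > 0"
    then have "\<epsilon> / (3 * K) > 0" using K by simp
    from LIMSEQ_D[OF X(3) this] obtain k where k: "norm (X k - l) < \<epsilon> / (3 * K)" by blast
    have close: "cmod (f n (X k) - f n l) < \<epsilon> / 3" for n
    proof -
      have "cmod (f n (X k) - f n l) \<le> K * norm (X k - l)"
        using bound[of "X k - l" n] diff[OF X(1) l] cstar_subalgebraD(4)[OF B X(1) l] by simp
      also have "\<dots> < \<epsilon> / 3" using k K by (simp add: field_simps)
      finally show ?thesis .
    qed
    have "\<epsilon> / 3 > 0" using \<epsilon> by simp
    from CauchyD[OF convergent_Cauchy[OF X(2)] this] obtain M
      where M: "\<And>m n. m \<ge> M \<Longrightarrow> n \<ge> M \<Longrightarrow> cmod (f m (X k) - f n (X k)) < \<epsilon> / 3" by blast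
    show "\<exists>M. \<forall>m\<ge>M. \<forall>n\<ge>M. cmod (f m l - f n l) < \<epsilon>"
    proof (intro exI allI impI)
      fix m n assume "m \<ge> M" "n \<ge> M"
      from M[OF this] have "cmod (f m (X k) - f n (X k)) < \<epsilon> / 3" .
      moreover have "f m l - f n l =
          (f m (X k) - f n (X k)) + ((f n (X k) - f n l) - (f m (X k) - f m l))" by simp
      then have "cmod (f m l - f n l) \<le> cmod (f m (X k) - f n (X k)) +
          (cmod (f n (X k) - f n l) + cmod (f m (X k) - f m l))"
        by (metis add_left_mono norm_triangle_ineq norm_triangle_ineq4 order_trans)
      ultimately show "cmod (f m l - f n l) < \<epsilon>" using close[of m] close[of n] by linarith
    qed
  qed
  then show "l \<in> {a \<in> B. convergent (\<lambda>n. f n a)}" using l by (simp add: Cauchy_convergent)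
qed


section \<open>The algebra of the span of the basis\<close>

lemma cinner_diff_left: "cinner (x - y) (z::'a::complex_inner) = cinner x z - cinner y z"
  using cinner_add_left[of x "- y" z] by simp

lemma cinner_diff_right: "cinner (x::'a::complex_inner) (y - z) = cinner x y - cinner x z"
  using cinner_add_right[of x y "- z"] by simp

lemma cinner_sum_left: "cinner (sum f A) (z::'a::complex_inner) = (\<Sum>i\<in>A. cinner (f i) z)"
  by (induction A rule: infinite_finite_induct) (auto simp: cinner_add_left)

section \<open>Weyl elements and the algebra they generate\<close>

lemma weyl_elem_mult: "weyl_elem x * weyl_elem y = phase x y *\<^sub>C weyl_elem (x + y)"
  by (metis weyl_relations_elem weyl_relations_def phase_def)

lemma star_weyl_elem: "star (weyl_elem x) = weyl_elem (- x)"
  by (metis weyl_relations_elem weyl_relations_def)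

lemma weyl_elem_0: "weyl_elem 0 = 1"
  by (simp add: weyl_elem_def completion_of_simps flip: one_weyl_def)

lemma weyl_elem_mult_orthogonal:
  assumes "cinner x y = 0" shows "weyl_elem x * weyl_elem y = weyl_elem (x + y)"
  using assms by (simp add: weyl_elem_mult phase_def symplectic_def)

lemma norm_weyl_elem: "norm (weyl_elem x) = 1"
proof -
  have "(norm (weyl_elem x))\<^sup>2 = norm (weyl_elem 0 :: 'a ccr)"
    by (simp add: star_weyl_elem weyl_elem_mult flip: cstar_identity)
  then show ?thesis by (simp add: weyl_elem_0 power2_eq_1_iff) (metis norm_ge_zero not_one_le_zero neg_0_le_iff_le)
qed

lemma cstar_subalgebra_B0: "cstar_subalgebra (B0 e)"
  unfolding B0_def cstar_generated_def by (rule cstar_subalgebra_Inter) simp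

lemma weyl_elem_in_B0: "x \<in> complex_vector.span (range e) \<Longrightarrow> weyl_elem x \<in> B0 e"
  unfolding B0_def cstar_generated_def by auto

lemma one_in_B0: "1 \<in> B0 e"
  using weyl_elem_in_B0[OF complex_vector.span_zero, of e] by (simp add: weyl_elem_0)

lemmas B0_closed = cstar_subalgebraD[OF cstar_subalgebra_B0]

lemma B0_subset:
  assumes "cstar_subalgebra B" "weyl_elem ` complex_vector.span (range e) \<subseteq> B"
  shows "B0 e \<subseteq> B"
  using assms unfolding B0_def cstar_generated_def by auto

text \<open>By the Weyl relations the span of the Weyl elements is already a *-algebra, so its
  closure is a C*-subalgebra containing the generators.\<close>

lemma B0_subset_closure:
  "B0 e \<subseteq> closure (complex_vector.span (weyl_elem ` complex_vector.span (range e)))"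
proof (rule B0_subset)
  let ?H = "complex_vector.span (range e)" and ?S = "complex_vector.span (weyl_elem ` complex_vector.span (range e))"
  note span_simps = complex_vector.span_zero complex_vector.span_add complex_vector.span_scale
  \<comment> \<open>Closure under products is obtained by linearity in the right factor first, then
    in the left one.\<close>
  have "weyl_elem x * b \<in> ?S" if x: "x \<in> ?H" and b: "b \<in> ?S" for x b
  proof -
    have "complex_vector.subspace {b. weyl_elem x * b \<in> ?S}"
      unfolding complex_vector.subspace_def by (simp add: ring_distribs span_simps)
    moreover have "weyl_elem x * weyl_elem y \<in> ?S" if "y \<in> ?H" for y
      using x that unfolding weyl_elem_mult
      by (intro complex_vector.span_scale complex_vector.span_base[OF imageI]
          complex_vector.span_add)
    ultimately have "?S \<subseteq> {b. weyl_elem x * b \<in> ?S}"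
      by (intro complex_vector.span_minimal) auto
    then show ?thesis using b by auto
  qed
  then have 1: "weyl_elem ` ?H \<subseteq> {a. \<forall>b\<in>?S. a * b \<in> ?S}" by auto
  have "complex_vector.subspace {a. \<forall>b\<in>?S. a * b \<in> ?S}"
    unfolding complex_vector.subspace_def by (simp add: ring_distribs span_simps)
  with 1 have mult: "?S \<subseteq> {a. \<forall>b\<in>?S. a * b \<in> ?S}" by (rule complex_vector.span_minimal)
  have "complex_vector.subspace {a. star a \<in> ?S}"
    unfolding complex_vector.subspace_def by (simp add: star_add star_scaleC span_simps)
  moreover have "weyl_elem ` ?H \<subseteq> {a. star a \<in> ?S}"
    by (auto simp: star_weyl_elem intro!: complex_vector.span_base complex_vector.span_neg)
  ultimately have star: "?S \<subseteq> {a. star a \<in> ?S}" by (intro complex_vector.span_minimal)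
  show "cstar_subalgebra (closure ?S)"
    using mult star by (intro cstar_subalgebra_closure) auto
  show "weyl_elem ` ?H \<subseteq> closure ?S"
    by (rule order_trans[OF complex_vector.span_superset closure_subset])
qed

section \<open>Geometry of the basis and of the finitely supported unitaries\<close>

lemma orthonormal_basis_cinner:
  "orthonormal_basis e \<Longrightarrow> cinner (e j) (e k) = (if j = k then 1 else 0)"
  unfolding orthonormal_basis_def by blast

text \<open>The condition is linear in \<open>x\<close> and holds for each basis vector. It supplies
  the fresh indices used in all limits below.\<close>

lemma eventually_orthogonal:
  assumes e: "orthonormal_basis e" and x: "x \<in> complex_vector.span (range e)"
  shows "\<forall>\<^sub>F n in sequentially. cinner x (e (int n)) = 0"
proof -
  let ?E = "{x. \<forall>\<^sub>F n in sequentially. cinner x (e (int n)) = 0}"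
  have "complex_vector.subspace ?E"
    unfolding complex_vector.subspace_def mem_Collect_eq
  proof (intro conjI ballI allI)
    show "\<forall>\<^sub>F n in sequentially. cinner (x + y) (e (int n)) = 0" if "x \<in> ?E" "y \<in> ?E" for x y
      using that unfolding mem_Collect_eq by eventually_elim (simp add: cinner_add_left)
    show "\<forall>\<^sub>F n in sequentially. cinner (c *\<^sub>C x) (e (int n)) = 0" if "x \<in> ?E" for c x
      using that unfolding mem_Collect_eq by eventually_elim (simp add: cinner_scaleC_left)
  qed simp
  moreover have "\<forall>\<^sub>F n in sequentially. cinner (e k) (e (int n)) = 0" for k
    using eventually_gt_at_top[of "nat \<bar>k\<bar>"]
    by eventually_elim (auto simp: orthonormal_basis_cinner[OF e])
  ultimately have "complex_vector.span (range e) \<subseteq> ?E"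
    by (intro complex_vector.span_minimal) auto
  then show ?thesis using x by auto
qed

text \<open>Every \<open>s\<close> in the dense span is orthogonal to \<open>y\<close>, so by
  Pythagoras \<open>norm y\<close> is at most \<open>norm (y - s)\<close>, which can be made
  arbitrarily small.\<close>

lemma orthogonal_basis_imp_zero:
  assumes e: "orthonormal_basis e" and y: "\<And>j. cinner y (e j) = 0"
  shows "y = 0"
proof -
  have "complex_vector.subspace {x. cinner y x = 0}"
    unfolding complex_vector.subspace_def by (simp add: cinner_add_right cinner_scaleC_right)
  then have sub: "complex_vector.span (range e) \<subseteq> {x. cinner y x = 0}"
    using y by (intro complex_vector.span_minimal) auto
  have "norm y < \<epsilon>" if \<epsilon>: "\<epsilon> > 0" for \<epsilon>
  proof -
    have "y \<in> closure (complex_vector.span (range e))" using e by (simp add: orthonormal_basis_def)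
    then obtain s where s: "s \<in> complex_vector.span (range e)" "dist s y < \<epsilon>"
      using \<epsilon> unfolding closure_approachable by auto
    have ys: "cinner y s = 0" using s(1) sub by auto
    then have sy: "cinner s y = 0" by (metis cinner_commute complex_cnj_zero)
    have "cinner (y - s) (y - s) = cinner y y + cinner s s"
      by (simp add: cinner_diff_left cinner_diff_right ys sy)
    then have "(norm (y - s))\<^sup>2 = (norm y)\<^sup>2 + (norm s)\<^sup>2"
      unfolding cinner_self by (simp flip: of_real_add of_real_power add: of_real_eq_iff)
    then have "(norm y)\<^sup>2 \<le> (norm (y - s))\<^sup>2" by simp
    then have "norm y \<le> norm (y - s)" by (rule power2_le_imp_le) simp
    then show ?thesis using s(2) by (simp add: dist_norm norm_minus_commute)
  qed
  then have "norm y \<le> 0" by (metis less_irrefl not_le)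
  then show ?thesis by simp
qed

text \<open>For \<bar>i\<bar> \<le> N the vector \<open>R (e i)\<close> has no component along
  \<open>e k\<close> with \<bar>k\<bar> > N, because \<open>R\<close> fixes \<open>e k\<close> and
  preserves inner products. So it is a finite combination of basis vectors.\<close>

lemma UZ_span:
  assumes e: "orthonormal_basis e" and R: "R \<in> UZ e" and x: "x \<in> complex_vector.span (range e)"
  shows "R x \<in> complex_vector.span (range e)"
proof -
  let ?H = "complex_vector.span (range e)"
  from R have "Vector_Spaces.linear scaleC scaleC R" and iso: "\<And>x y. cinner (R x) (R y) = cinner x y"
    by (auto simp: UZ_def unitary_def)
  then interpret R: Vector_Spaces.linear scaleC scaleC R by simp
  from R obtain N where N: "\<And>i. \<bar>i\<bar> > N \<Longrightarrow> R (e i) = e i" by (auto simp: UZ_def)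
  have basis: "R (e i) \<in> ?H" for i
  proof (cases "\<bar>i\<bar> > N")
    case True
    then show ?thesis by (simp add: N complex_vector.span_base)
  next
    case False
    \<comment> \<open>The finite Fourier sum of \<open>R (e i)\<close>; it equals
      \<open>R (e i)\<close> because the difference is orthogonal to the whole basis.\<close>
    define s where "s = (\<Sum>j\<in>{-N..N}. cinner (R (e i)) (e j) *\<^sub>C e j)"
    have "cinner (R (e i) - s) (e k) = 0" for k
    proof -
      have s: "cinner s (e k) = (if k \<in> {-N..N} then cinner (R (e i)) (e k) else 0)"
        by (simp add: s_def cinner_sum_left cinner_scaleC_left orthonormal_basis_cinner[OF e]
            if_distrib sum.delta' cong: if_cong)
      have "cinner (R (e i)) (e k) = 0" if "\<not> k \<in> {-N..N}"
      proof -
        from that have k: "\<bar>k\<bar> > N" by auto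
        then have "cinner (R (e i)) (e k) = cinner (e i) (e k)" using iso[of "e i" "e k"] N[OF k] by simp
        then show ?thesis using k False by (auto simp: orthonormal_basis_cinner[OF e])
      qed
      then show ?thesis by (auto simp: cinner_diff_left s)
    qed
    from orthogonal_basis_imp_zero[OF e this] have "R (e i) = s" by simp
    then show ?thesis
      unfolding s_def
      by (metis (no_types, lifting) complex_vector.span_base complex_vector.span_scale
          complex_vector.span_sum rangeI)
  qed
  have "complex_vector.subspace {x. R x \<in> ?H}"
    unfolding complex_vector.subspace_def
    by (auto simp: R.add R.scale R.zero complex_vector.span_zero
        intro: complex_vector.span_add complex_vector.span_scale)
  then have "?H \<subseteq> {x. R x \<in> ?H}" using basis by (intro complex_vector.span_minimal) auto
  then show ?thesis using x by auto
qed

text \<open>The reflection in the hyperplane orthogonal to v = e m - e n. The usual factor 2 / <v,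
  v> is 1 for distinct indices of an orthonormal family.\<close>

definition swap_basis :: "(int \<Rightarrow> 'h::complex_hilbert) \<Rightarrow> int \<Rightarrow> int \<Rightarrow> 'h \<Rightarrow> 'h" where
  "swap_basis e m n x = x - cinner x (e m - e n) *\<^sub>C (e m - e n)"

lemma swap_basis_eq:
  assumes "cinner x (e m) = 0" "cinner x (e n) = 0" shows "swap_basis e m n x = x"
  using assms by (simp add: swap_basis_def cinner_diff_right)

lemma swap_basis_left:
  assumes e: "orthonormal_basis e" "m \<noteq> n" shows "swap_basis e m n (c *\<^sub>C e m) = c *\<^sub>C e n"
  using assms
  by (simp add: swap_basis_def cinner_diff_right cinner_scaleC_left orthonormal_basis_cinner
      complex_vector.scale_right_diff_distrib)

lemma swap_basis_add: "swap_basis e m n (x + y) = swap_basis e m n x + swap_basis e m n y"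
  by (simp add: swap_basis_def cinner_add_left scaleC_add_left)

lemma swap_basis_OZ:
  assumes e: "orthonormal_basis e" and mn: "m \<noteq> n"
  shows "swap_basis e m n \<in> OZ e"
proof -
  define v where "v = e m - e n"
  note ip = orthonormal_basis_cinner[OF e]
  have vv: "cinner v v = 2"
    using mn by (simp add: v_def cinner_diff_left cinner_diff_right ip)
  have S: "swap_basis e m n x = x - cinner x v *\<^sub>C v" for x by (simp add: swap_basis_def v_def)
  have "Vector_Spaces.linear scaleC scaleC (swap_basis e m n)"
    by unfold_locales
      (auto simp: S cinner_add_left cinner_scaleC_left scaleC_add_left scaleC_add_right
        complex_vector.scale_right_diff_distrib)
  moreover have "cinner (swap_basis e m n x) (swap_basis e m n y) = cinner x y" for x y
    using cinner_commute[of v y]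
    by (simp add: S cinner_diff_left cinner_diff_right cinner_scaleC_left cinner_scaleC_right vv
        algebra_simps)
  moreover have "swap_basis e m n (swap_basis e m n x) = x" for x
    by (simp add: S cinner_diff_left cinner_scaleC_left vv flip: complex_vector.scale_left_diff_distrib)
  then have "surj (swap_basis e m n)" by (metis surjI)
  moreover have "swap_basis e m n (e i) = e i" if "\<bar>i\<bar> > \<bar>m\<bar> + \<bar>n\<bar> + 1" for i
    using that by (intro swap_basis_eq) (auto simp: ip)
  then have "\<exists>N>0. \<forall>i. \<bar>i\<bar> > N \<longrightarrow> swap_basis e m n (e i) = e i"
    by (intro exI[of _ "\<bar>m\<bar> + \<bar>n\<bar> + 1"]) auto
  moreover have "cinner (swap_basis e m n (e i)) (e j) \<in> \<real>" for i j
    by (simp add: swap_basis_def cinner_diff_left cinner_diff_right cinner_scaleC_left ip)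
  ultimately show ?thesis by (auto simp: OZ_def UZ_def unitary_def)
qed


section \<open>Compressed limits of a rotatable state\<close>

locale rotatable =
  fixes e :: "int \<Rightarrow> 'h::complex_hilbert" and \<omega> :: "'h ccr \<Rightarrow> complex"
  assumes onb: "orthonormal_basis e" and rotatable: "\<omega> \<in> rotatable_states e"
begin

lemma state: "\<omega> \<in> states_on (B0 e)"
  using rotatable by (simp add: rotatable_states_def)

lemmas state_simps = states_onD[OF state]
lemmas state_le = state_norm_le[OF cstar_subalgebra_B0 one_in_B0 state]
lemmas ip = orthonormal_basis_cinner[OF onb]

lemma basis_in_span: "z *\<^sub>C e k \<in> complex_vector.span (range e)"
  by (intro complex_vector.span_scale complex_vector.span_base rangeI)

lemmas span_intros = complex_vector.span_add complex_vector.span_zero complex_vector.span_neg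
  basis_in_span

lemma OZ_B0:
  assumes R: "R \<in> OZ e" shows "ccr_map R ` B0 e \<subseteq> B0 e"
proof -
  from R have "unitary R" "R \<in> UZ e" by (auto simp: OZ_def UZ_def)
  note h = ccr_map_unitary[OF this(1)]
  have "B0 e \<subseteq> ccr_map R -` B0 e"
    by (rule B0_subset)
      (auto intro!: cstar_subalgebra_vimage h cstar_subalgebra_B0 weyl_elem_in_B0
        UZ_span[OF onb \<open>R \<in> UZ e\<close>] simp: h(3))
  then show ?thesis by blast
qed

text \<open>The reflection fixes \<open>x\<close> and carries \<open>z *\<^sub>C e m\<close> to
  \<open>z *\<^sub>C e n\<close>. Hence it does not matter which index orthogonal to
  \<open>x\<close> carries \<open>z\<close>.\<close>

lemma state_weyl_swap:
  assumes x: "x \<in> complex_vector.span (range e)" "cinner x (e m) = 0" "cinner x (e n) = 0"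
  shows "\<omega> (weyl_elem (x + z *\<^sub>C e m)) = \<omega> (weyl_elem (x + z *\<^sub>C e n))"
proof (cases "m = n")
  case False
  let ?R = "swap_basis e m n"
  have R: "?R \<in> OZ e" by (rule swap_basis_OZ[OF onb False])
  then have "unitary ?R" by (auto simp: OZ_def UZ_def)
  then have "ccr_map ?R (weyl_elem (x + z *\<^sub>C e m)) = weyl_elem (x + z *\<^sub>C e n)"
    by (simp add: ccr_map_unitary swap_basis_add swap_basis_eq x swap_basis_left[OF onb False])
  moreover have "weyl_elem (x + z *\<^sub>C e m) \<in> B0 e"
    by (intro weyl_elem_in_B0 span_intros x)
  then have "\<omega> (ccr_map ?R (weyl_elem (x + z *\<^sub>C e m))) = \<omega> (weyl_elem (x + z *\<^sub>C e m))"
    using rotatable R by (simp add: rotatable_states_def)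
  ultimately show ?thesis by simp
qed simp

text \<open>
  With \<open>s / 2\<close> instead of \<open>s\<close> the compressed functionals never vanish, so they can always be normalised.
\<close>

definition tilt :: "complex \<Rightarrow> complex \<Rightarrow> nat \<Rightarrow> 'h ccr" where
  "tilt z s n = 1 + (s / 2) *\<^sub>C weyl_elem (z *\<^sub>C e (int n))"

definition compressed :: "complex \<Rightarrow> complex \<Rightarrow> nat \<Rightarrow> 'h ccr \<Rightarrow> complex" where
  "compressed z s n a = \<omega> (star (tilt z s n) * a * tilt z s n)"

text \<open>The value 0 outside \<open>B0 e\<close> follows the convention of
  \<open>states_on\<close>.\<close>

definition compressed_lim :: "complex \<Rightarrow> complex \<Rightarrow> 'h ccr \<Rightarrow> complex" where
  "compressed_lim z s a = (if a \<in> B0 e then lim (\<lambda>n. compressed z s n a) else 0)"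

text \<open>The value of the limit functional at the unit, see \<open>compressed_lim_1\<close>. The
  constant 5/4 is 1 + \<bar>s / 2\<bar>^2 for \<bar>s\<bar> = 1.\<close>

definition mass :: "complex \<Rightarrow> complex \<Rightarrow> real" where
  "mass z s = 5 / 4 + Re (s * \<omega> (weyl_elem (z *\<^sub>C e 0)))"

lemma tilt_in_B0: "tilt z s n \<in> B0 e"
  unfolding tilt_def by (intro B0_closed one_in_B0 weyl_elem_in_B0 span_intros)

lemma compressed_simps:
  assumes "a \<in> B0 e"
  shows "b \<in> B0 e \<Longrightarrow> compressed z s n (a + b) = compressed z s n a + compressed z s n b"
    "b \<in> B0 e \<Longrightarrow> compressed z s n (a - b) = compressed z s n a - compressed z s n b"
    "compressed z s n (c *\<^sub>C a) = c * compressed z s n a"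
  using assms tilt_in_B0[of z s n]
  by (simp_all add: compressed_def ring_distribs state_simps B0_closed
      state_diff[OF cstar_subalgebra_B0 one_in_B0 state])

text \<open>Each \<open>tilt\<close> has norm at most 1 + 1/2, and 9/4 is the square of that. The
  bound is uniform in \<open>n\<close>, as \<open>closed_convergent\<close> requires.\<close>

lemma compressed_bound:
  assumes "a \<in> B0 e" "cmod s = 1"
  shows "cmod (compressed z s n a) \<le> 9 / 4 * norm a"
proof -
  have t: "norm (tilt z s n) \<le> 3 / 2"
    using norm_triangle_ineq[of 1 "(s / 2) *\<^sub>C weyl_elem (z *\<^sub>C e (int n))"] assms(2)
    by (simp add: tilt_def norm_weyl_elem norm_divide)
  have "cmod (compressed z s n a) \<le> norm (star (tilt z s n) * a * tilt z s n)"
    unfolding compressed_def by (intro state_le B0_closed assms tilt_in_B0)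
  also have "\<dots> \<le> norm (star (tilt z s n)) * norm a * norm (tilt z s n)"
    by (meson mult_right_mono norm_ge_zero norm_mult_ineq order_trans)
  also have "\<dots> \<le> 3 / 2 * norm a * (3 / 2)" using t by (intro mult_mono) auto
  finally show ?thesis by simp
qed

text \<open>Orthogonality makes all phases between the two Weyl elements trivial. Of the four terms
  of the expanded product two are multiples of \<open>weyl_elem x\<close>, with coefficients 1 and
  1/4.\<close>

lemma compressed_weyl:
  assumes x: "x \<in> complex_vector.span (range e)" "cinner x (e (int n)) = 0" and s: "cmod s = 1"
  shows "compressed z s n (weyl_elem x) = 5 / 4 * \<omega> (weyl_elem x)
    + s / 2 * \<omega> (weyl_elem (x + z *\<^sub>C e (int n))) + cnj s / 2 * \<omega> (weyl_elem (x + (- z) *\<^sub>C e (int n)))"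
proof -
  define y where "y = z *\<^sub>C e (int n)"
  have y': "(- z) *\<^sub>C e (int n) = - y" by (simp add: y_def complex_vector.scale_minus_left)
  have o: "cinner x y = 0" "cinner y x = 0"
    using x(2) cinner_commute[of "e (int n)" x] by (auto simp: y_def cinner_scaleC_right cinner_scaleC_left)
  then have comm: "weyl_elem x * weyl_elem y = weyl_elem (x + y)"
    "weyl_elem (- y) * weyl_elem x = weyl_elem (x + - y)"
    by (simp_all add: weyl_elem_mult_orthogonal add.commute)
  have "phase x y = 1" using o by (simp add: phase_def symplectic_def)
  then have inv: "weyl_elem (x + - y) * weyl_elem y = weyl_elem x"
    by (simp add: weyl_elem_mult phase_add_left del: add_uminus_conv_diff)
  have ss: "cnj s * s = 1" using s complex_norm_square[of s] by (simp add: mult.commute)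
  have "star (tilt z s n) * weyl_elem x = weyl_elem x + (cnj s / 2) *\<^sub>C weyl_elem (x + - y)"
    by (simp add: tilt_def y_def[symmetric] star_add star_scaleC star_weyl_elem distrib_right
        comm(2) del: add_uminus_conv_diff)
  then have "star (tilt z s n) * weyl_elem x * tilt z s n = weyl_elem x + (s / 2) *\<^sub>C weyl_elem (x + y)
      + (cnj s / 2) *\<^sub>C weyl_elem (x + - y) + ((cnj s / 2) * (s / 2)) *\<^sub>C weyl_elem x"
    by (simp add: tilt_def y_def[symmetric] distrib_left distrib_right comm(1) inv ac_simps
        scaleC_add_right
        del: add_uminus_conv_diff)
  also have "\<dots> = (5 / 4) *\<^sub>C weyl_elem x + (s / 2) *\<^sub>C weyl_elem (x + y)
      + (cnj s / 2) *\<^sub>C weyl_elem (x + - y)"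
    using ss scaleC_add_left[of 1 "1/4" "weyl_elem x"] by (simp add: algebra_simps)
  finally show ?thesis
    unfolding compressed_def y' y_def[symmetric]
    using x(1) by (simp add: y_def state_simps B0_closed weyl_elem_in_B0 span_intros del: add_uminus_conv_diff)
qed

text \<open>For all large \<open>n\<close> the vector \<open>x\<close> is orthogonal to
  \<open>e (int n)\<close>, and \<open>state_weyl_swap\<close> moves both \<open>z\<close> and
  \<open>- z\<close> from that index to the fixed \<open>k\<close>.\<close>

lemma compressed_weyl_LIMSEQ:
  assumes x: "x \<in> complex_vector.span (range e)" "cinner x (e k) = 0" and s: "cmod s = 1"
  shows "(\<lambda>n. compressed z s n (weyl_elem x)) \<longlonglongrightarrow> 5 / 4 * \<omega> (weyl_elem x)
    + s / 2 * \<omega> (weyl_elem (x + z *\<^sub>C e k)) + cnj s / 2 * \<omega> (weyl_elem (x + (- z) *\<^sub>C e k))"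
    (is "_ \<longlonglongrightarrow> ?l")
proof (rule tendsto_eventually)
  show "\<forall>\<^sub>F n in sequentially. compressed z s n (weyl_elem x) = ?l"
    using eventually_orthogonal[OF onb x(1)]
  proof eventually_elim
    case (elim n)
    show ?case
      unfolding compressed_weyl[OF x(1) elim s] state_weyl_swap[OF x(1) elim x(2)] ..
  qed
qed

text \<open>Convergence holds on Weyl elements, passes to their span by linearity and to the closure
  by the uniform bound.\<close>

lemma compressed_LIMSEQ:
  assumes a: "a \<in> B0 e" and s: "cmod s = 1"
  shows "(\<lambda>n. compressed z s n a) \<longlonglongrightarrow> compressed_lim z s a"
proof -
  let ?S = "{a \<in> B0 e. convergent (\<lambda>n. compressed z s n a)}"
  have "complex_vector.subspace ?S"
    unfolding complex_vector.subspace_def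
  proof (intro conjI ballI allI)
    show "0 \<in> ?S"
      using compressed_simps(3)[OF B0_closed(1), where c = 0] by (simp add: B0_closed convergent_const)
    show "a + b \<in> ?S" if "a \<in> ?S" "b \<in> ?S" for a b
      using that by (simp add: compressed_simps B0_closed convergent_add)
    show "c *\<^sub>C a \<in> ?S" if "a \<in> ?S" for c a
      using that by (simp add: compressed_simps B0_closed convergent_mult convergent_const)
  qed
  moreover have "weyl_elem x \<in> ?S" if x: "x \<in> complex_vector.span (range e)" for x
  proof -
    obtain k where "cinner x (e k) = 0"
      using eventually_orthogonal[OF onb x] unfolding eventually_sequentially by blast
    from compressed_weyl_LIMSEQ[OF x this s] show ?thesis
      using weyl_elem_in_B0[OF x] by (auto simp: convergent_def)
  qed
  ultimately have "complex_vector.span (weyl_elem ` complex_vector.span (range e)) \<subseteq> ?S"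
    by (intro complex_vector.span_minimal) auto
  moreover have "closed ?S"
    by (rule closed_convergent[OF cstar_subalgebra_B0 compressed_simps(2) compressed_bound])
      (auto simp: s)
  ultimately have "closure (complex_vector.span (weyl_elem ` complex_vector.span (range e))) \<subseteq> ?S"
    by (rule closure_minimal)
  then have "convergent (\<lambda>n. compressed z s n a)"
    using a B0_subset_closure[of e] by auto
  then show ?thesis using a by (simp add: compressed_lim_def convergent_LIMSEQ_iff)
qed

lemma compressed_lim_weyl:
  assumes "x \<in> complex_vector.span (range e)" "cinner x (e k) = 0" "cmod s = 1"
  shows "compressed_lim z s (weyl_elem x) = 5 / 4 * \<omega> (weyl_elem x)
    + s / 2 * \<omega> (weyl_elem (x + z *\<^sub>C e k)) + cnj s / 2 * \<omega> (weyl_elem (x + (- z) *\<^sub>C e k))"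
  using LIMSEQ_unique[OF compressed_LIMSEQ[OF weyl_elem_in_B0] compressed_weyl_LIMSEQ] assms by blast

text \<open>At \<open>x = 0\<close> the last two terms of \<open>compressed_lim_weyl\<close> are
  complex conjugates, so they add up to the real part in \<open>mass\<close>.\<close>

lemma compressed_lim_1:
  assumes "cmod s = 1" shows "compressed_lim z s 1 = mass z s"
proof -
  have "\<omega> (weyl_elem (- (z *\<^sub>C e 0))) = cnj (\<omega> (weyl_elem (z *\<^sub>C e 0)))"
    using state_star[OF cstar_subalgebra_B0 one_in_B0 state weyl_elem_in_B0[OF basis_in_span]]
    by (simp add: star_weyl_elem)
  then show ?thesis
    using compressed_lim_weyl[of 0 0 s z] assms
    by (simp add: weyl_elem_0 state_simps mass_def complex_vector.span_zero
        complex_vector.scale_minus_left complex_eq_iff)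
      (simp add: field_simps)
qed

text \<open>A state has modulus at most 1 on a Weyl element, so the mass is at least 1/4.\<close>

lemma mass_pos:
  assumes "cmod s = 1" shows "mass z s > 0"
proof -
  have "cmod (s * \<omega> (weyl_elem (z *\<^sub>C e 0))) \<le> 1"
    using state_le[OF weyl_elem_in_B0[OF basis_in_span]] assms by (simp add: norm_mult norm_weyl_elem)
  then show ?thesis
    using abs_Re_le_cmod[of "s * \<omega> (weyl_elem (z *\<^sub>C e 0))"] by (simp add: mass_def)
qed

lemma mass_minus: "mass z s + mass z (- s) = 5 / 2"
  by (simp add: mass_def)

lemma compressed_lim_rotatable:
  assumes s: "cmod s = 1"
  shows "(\<lambda>a. compressed_lim z s a / mass z s) \<in> rotatable_states e"
proof -
  let ?L = "compressed_lim z s"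
  note lim = compressed_LIMSEQ[OF _ s, of _ z]
  have add: "?L (a + b) = ?L a + ?L b" if "a \<in> B0 e" "b \<in> B0 e" for a b
    using LIMSEQ_unique[OF lim[OF B0_closed(2)[OF that]]] tendsto_add[OF lim[OF that(1)] lim[OF that(2)]]
    by (simp add: compressed_simps that)
  have scale: "?L (c *\<^sub>C a) = c * ?L a" if "a \<in> B0 e" for c a
    using LIMSEQ_unique[OF lim[OF B0_closed(3)[OF that]]] tendsto_mult_left[OF lim[OF that], of c]
    by (simp add: compressed_simps that)
  have pos: "?L (star a * a) \<in> \<real>\<^sub>\<ge>\<^sub>0" if a: "a \<in> B0 e" for a
  proof (rule closed_sequentially[OF closed_nonneg_Reals_complex])
    show "(\<lambda>n. compressed z s n (star a * a)) \<longlonglongrightarrow> ?L (star a * a)"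
      by (intro lim B0_closed a)
    fix n
    \<comment> \<open>Regrouped in this way, each compressed value is a value of
      \<open>\<omega>\<close> at a square; the nonnegative reals are closed, so the limit stays
      there.\<close>
    have "star (tilt z s n) * (star a * a) * tilt z s n = star (a * tilt z s n) * (a * tilt z s n)"
      by (simp add: star_mult mult.assoc)
    then show "compressed z s n (star a * a) \<in> \<real>\<^sub>\<ge>\<^sub>0"
      unfolding compressed_def by (simp add: state_simps(3) B0_closed a tilt_in_B0)
  qed
  have inv: "?L (ccr_map R a) = ?L a" if R: "R \<in> OZ e" and a: "a \<in> B0 e" for R a
  proof -
    from R have U: "unitary R" and "\<exists>N. \<forall>i. \<bar>i\<bar> > N \<longrightarrow> R (e i) = e i" by (auto simp: OZ_def UZ_def)
    then obtain N where N: "\<And>i. \<bar>i\<bar> > N \<Longrightarrow> R (e i) = e i" by blast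
    from U have "Vector_Spaces.linear scaleC scaleC R" by (simp add: unitary_def)
    then interpret R: Vector_Spaces.linear scaleC scaleC R .
    note h = ccr_map_unitary[OF U]
    have Ra: "ccr_map R a \<in> B0 e" using OZ_B0[OF R] a by blast
    \<comment> \<open>Once \<open>n\<close> exceeds \<open>N\<close>, \<open>R\<close> fixes
      \<open>e (int n)\<close>, so \<open>ccr_map R\<close> fixes the tilt and invariance of
      \<open>\<omega>\<close> applies to the whole product.\<close>
    have "\<forall>\<^sub>F n in sequentially. compressed z s n a = compressed z s n (ccr_map R a)"
      using eventually_gt_at_top[of "nat \<bar>N\<bar>"]
    proof eventually_elim
      case (elim n)
      have "R (z *\<^sub>C e (int n)) = z *\<^sub>C R (e (int n))"
        by (rule R.scale)
      then have "R (z *\<^sub>C e (int n)) = z *\<^sub>C e (int n)" using elim by (simp add: N)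
      \<comment> \<open>\<open>star_hom\<close> does not demand preservation of the unit; it comes
        from \<open>weyl_elem 0 = 1\<close> and linearity of \<open>R\<close>.\<close>
      moreover have "ccr_map R 1 = 1"
        using h(3)[of 0] by (simp add: weyl_elem_0 R.zero)
      ultimately have "ccr_map R (tilt z s n) = tilt z s n"
        using h(1) by (simp add: tilt_def star_hom_def h(3))
      then have "ccr_map R (star (tilt z s n) * a * tilt z s n)
          = star (tilt z s n) * ccr_map R a * tilt z s n"
        using h(1) by (simp add: star_hom_def)
      moreover have "\<omega> (ccr_map R (star (tilt z s n) * a * tilt z s n))
          = \<omega> (star (tilt z s n) * a * tilt z s n)"
        using rotatable R a by (simp add: rotatable_states_def B0_closed tilt_in_B0)
      ultimately show ?case by (simp add: compressed_def)
    qed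
    from LIMSEQ_unique[OF lim[OF Ra] Lim_transform_eventually[OF lim[OF a] this]] show ?thesis .
  qed
  have "c / complex_of_real (mass z s) \<in> \<real>\<^sub>\<ge>\<^sub>0" if "c \<in> \<real>\<^sub>\<ge>\<^sub>0" for c
    using that mass_pos[OF s, of z]
    by (simp add: complex_nonneg_Reals_iff Re_divide_of_real Im_divide_of_real)
  moreover have "?L a = 0" if "a \<notin> B0 e" for a using that by (simp add: compressed_lim_def)
  ultimately show ?thesis
    using mass_pos[OF s, of z]
    by (simp add: rotatable_states_def states_on_def add scale pos inv compressed_lim_1[OF s]
        add_divide_distrib)
qed

subsection \<open>Extreme rotatable states\<close>

text \<open>Weyl elements determine continuous linear functionals on \<open>B0 e\<close>, and
  outside \<open>B0 e\<close> all three states vanish; so an equality of functions results, as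
  \<open>extreme_functional\<close> demands.\<close>

lemma state_eqI:
  assumes f: "f \<in> states_on (B0 e)" and g: "g \<in> states_on (B0 e)" and h: "h \<in> states_on (B0 e)"
    and eq: "\<And>x. x \<in> complex_vector.span (range e) \<Longrightarrow>
      f (weyl_elem x) = t * g (weyl_elem x) + u * h (weyl_elem x)"
  shows "f = (\<lambda>a. t * g a + u * h a)"
proof
  fix a
  note cont = continuous_on_state[OF cstar_subalgebra_B0 one_in_B0]
  show "f a = t * g a + u * h a"
  proof (cases "a \<in> B0 e")
    case True
    show ?thesis
    proof (rule functional_eq_on_closure_span[OF cstar_subalgebra_B0 _ B0_subset_closure _ _ _ _ _ _ _ True])
      show "weyl_elem ` complex_vector.span (range e) \<subseteq> B0 e" by (auto intro: weyl_elem_in_B0)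
      show "continuous_on (B0 e) f" by (rule cont[OF f])
      show "continuous_on (B0 e) (\<lambda>a. t * g a + u * h a)"
        by (intro continuous_intros cont g h)
    qed (auto simp: states_onD[OF f] states_onD[OF g] states_onD[OF h] eq algebra_simps)
  qed (simp add: states_onD(5)[OF f] states_onD(5)[OF g] states_onD(5)[OF h])
qed

text \<open>The normalised limits for \<open>s\<close> and \<open>- s\<close> are rotatable states
  with \<open>\<omega>\<close> as a proper convex combination. Extremality makes them equal to each
  other, hence to \<open>\<omega>\<close>.\<close>

lemma extreme_imp_compressed_eq:
  assumes ext: "extreme_functional \<omega> (rotatable_states e)" and s: "cmod s = 1"
    and a: "a \<in> B0 e"
  shows "compressed_lim z s a = mass z s * \<omega> a"
proof -
  define \<psi> where "\<psi> s a = compressed_lim z s a / mass z s" for s a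
  have s': "cmod (- s) = 1" using s by simp
  have \<psi>: "\<psi> s \<in> rotatable_states e" "\<psi> (- s) \<in> rotatable_states e"
    unfolding \<psi>_def by (rule compressed_lim_rotatable s s')+
  then have \<psi>_state: "\<psi> s \<in> states_on (B0 e)" "\<psi> (- s) \<in> states_on (B0 e)"
    by (simp_all add: rotatable_states_def)
  note pos = mass_pos[OF s, of z] mass_pos[OF s', of z]
  \<comment> \<open>The weights are proportional to the masses, so they cancel the normalisations;
    they sum to 1 because the masses sum to 5/2.\<close>
  define t where "t = 2 / 5 * mass z (- s)"
  have t: "0 < t" "t < 1" "1 - t = 2 / 5 * mass z s"
    using pos mass_minus[of z s] by (auto simp: t_def)
  have \<omega>_eq: "\<omega> = (\<lambda>a. complex_of_real (1 - t) * \<psi> s a + complex_of_real t * \<psi> (- s) a)"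
  proof (rule state_eqI[OF state \<psi>_state])
    fix x assume x: "x \<in> complex_vector.span (range e)"
    obtain k where k: "cinner x (e k) = 0"
      using eventually_orthogonal[OF onb x] unfolding eventually_sequentially by blast
    have "complex_of_real (1 - t) * \<psi> s (weyl_elem x) + complex_of_real t * \<psi> (- s) (weyl_elem x)
        = 2 / 5 * (compressed_lim z s (weyl_elem x) + compressed_lim z (- s) (weyl_elem x))"
      unfolding t(3) using pos by (simp add: \<psi>_def t_def distrib_left)
    \<comment> \<open>The terms with \<open>s\<close> and \<open>- s\<close> cancel, leaving 5/4 +
      5/4 = 5/2 times \<open>\<omega>\<close>.\<close>
    also have "\<dots> = \<omega> (weyl_elem x)"
      unfolding compressed_lim_weyl[OF x k s] compressed_lim_weyl[OF x k s'] by simp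
    finally show "\<omega> (weyl_elem x) = complex_of_real (1 - t) * \<psi> s (weyl_elem x)
        + complex_of_real t * \<psi> (- s) (weyl_elem x)" ..
  qed
  have "\<psi> s = \<psi> (- s)"
    using ext \<psi> t(1,2) \<omega>_eq unfolding extreme_functional_def by blast
  then have "\<omega> a = \<psi> s a"
    using fun_cong[OF \<omega>_eq, of a] by (simp add: algebra_simps)
  then show ?thesis using pos by (simp add: \<psi>_def)
qed

text \<open>For each \<open>s\<close> the terms with 5/4 cancel in
  \<open>extreme_imp_compressed_eq\<close>, leaving a linear equation for the values
  \<open>A\<close> and \<open>A'\<close> at \<open>z\<close> and \<open>- z\<close>. The choice
  \<open>s = 1\<close> yields their sum and \<open>s = \<i>\<close> their difference.\<close>

lemma extreme_imp_weyl_factor: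
  assumes ext: "extreme_functional \<omega> (rotatable_states e)"
    and x: "x \<in> complex_vector.span (range e)" "cinner x (e k) = 0"
  shows "\<omega> (weyl_elem (x + z *\<^sub>C e k)) = \<omega> (weyl_elem x) * \<omega> (weyl_elem (z *\<^sub>C e 0))"
proof -
  define w where "w = \<omega> (weyl_elem (z *\<^sub>C e 0))"
  define A where "A = \<omega> (weyl_elem (x + z *\<^sub>C e k))"
  define A' where "A' = \<omega> (weyl_elem (x + (- z) *\<^sub>C e k))"
  have eq: "s / 2 * A + cnj s / 2 * A' = complex_of_real (Re (s * w)) * \<omega> (weyl_elem x)"
    if s: "cmod s = 1" for s
    using extreme_imp_compressed_eq[OF ext s weyl_elem_in_B0[OF x(1)], of z]
    unfolding compressed_lim_weyl[OF x s] mass_def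
    by (simp add: w_def A_def A'_def algebra_simps)
  have "\<i> * (A - A') = \<i> * (2 * \<i> * complex_of_real (Im w) * \<omega> (weyl_elem x))"
    using eq[of \<i>] by (simp add: algebra_simps)
  then have "A - A' = 2 * \<i> * complex_of_real (Im w) * \<omega> (weyl_elem x)" by simp
  moreover have "A + A' = 2 * complex_of_real (Re w) * \<omega> (weyl_elem x)"
    using eq[of 1] by (simp add: field_simps)
  ultimately have "2 * A = 2 * ((complex_of_real (Re w) + \<i> * complex_of_real (Im w)) * \<omega> (weyl_elem x))"
    by (simp add: algebra_simps)
  then show ?thesis by (simp add: A_def w_def mult.commute flip: complex_eq)
qed

section \<open>From Weyl elements to products of embedded elements\<close>

lemma ccr_embed_in_B0: "ccr_embed e k a \<in> B0 e"
proof -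
  note h = ccr_embed[OF onb, of k]
  have sub: "cstar_subalgebra (ccr_embed e k -` B0 e)"
    by (rule cstar_subalgebra_vimage[OF h(1,2) cstar_subalgebra_B0])
  then have "complex_vector.span (range weyl_elem) \<subseteq> ccr_embed e k -` B0 e"
    unfolding cstar_subalgebra_def
    by (intro complex_vector.span_minimal) (auto simp: h(3) intro: weyl_elem_in_B0[OF basis_in_span])
  then have "closure (complex_vector.span (range weyl_elem)) \<subseteq> ccr_embed e k -` B0 e"
    by (rule closure_minimal[OF _ cstar_subalgebraD(7)[OF sub]])
  then show ?thesis unfolding ccr_generated by auto
qed

lemma ccr_embed_one: "ccr_embed e k 1 = 1"
  using ccr_embed(3)[OF onb, of k 0] by (simp add: weyl_elem_0)

text \<open>The restriction of \<open>\<omega>\<close> to one tensor factor; index 0 supplies the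
  state \<phi> of the theorem.\<close>

lemma marginal_state: "\<omega> \<circ> ccr_embed e k \<in> states_on UNIV"
  using ccr_embed(1)[OF onb, of k]
  by (simp add: states_on_def star_hom_def state_simps ccr_embed_in_B0 ccr_embed_one
      B0_closed states_onD(3)[OF state])

text \<open>The Weyl element in front absorbs the factors of the product that have already been split off.\<close>

lemma extreme_imp_product:
  fixes a :: "int \<Rightarrow> complex ccr"
  assumes ext: "extreme_functional \<omega> (rotatable_states e)"
  shows "\<lbrakk>distinct ks; x \<in> complex_vector.span (range e); \<And>k. k \<in> set ks \<Longrightarrow> cinner x (e k) = 0\<rbrakk> \<Longrightarrow>
    \<omega> (weyl_elem x * (\<Prod>k\<leftarrow>ks. ccr_embed e k (a k)))
      = \<omega> (weyl_elem x) * (\<Prod>k\<leftarrow>ks. \<omega> (ccr_embed e 0 (a k)))"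
proof (induction ks arbitrary: x)
  case (Cons k ks)
  let ?P = "\<Prod>k\<leftarrow>ks. ccr_embed e k (a k)" and ?p = "\<Prod>k\<leftarrow>ks. \<omega> (ccr_embed e 0 (a k))"
  note hom = ccr_embed(1)[OF onb, unfolded star_hom_def]
  have P: "?P \<in> B0 e"
    by (induction ks) (auto simp: one_in_B0 B0_closed ccr_embed_in_B0)
  have x: "weyl_elem x \<in> B0 e" by (rule weyl_elem_in_B0) fact
  have cont: "continuous_on UNIV (\<lambda>b. \<omega> (f b))"
    if "continuous_on UNIV f" "range f \<subseteq> B0 e" for f :: "complex ccr \<Rightarrow> 'h ccr"
    using continuous_on_compose2[OF continuous_on_state[OF cstar_subalgebra_B0 one_in_B0 state] that] .
  \<comment> \<open>With the other factors fixed both sides are continuous and linear in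
    \<open>b\<close>, so it suffices to take \<open>b\<close> among the Weyl elements.\<close>
  have "\<omega> (weyl_elem x * (ccr_embed e k b * ?P)) = \<omega> (weyl_elem x) * \<omega> (ccr_embed e 0 b) * ?p" for b
  proof (rule functional_eq_on_closure_span[OF cstar_subalgebra_UNIV subset_UNIV,
        where S = "range weyl_elem" and f = "\<lambda>b. \<omega> (weyl_elem x * (ccr_embed e k b * ?P))"
          and g = "\<lambda>b. \<omega> (weyl_elem x) * \<omega> (ccr_embed e 0 b) * ?p"])
    show "UNIV \<subseteq> closure (complex_vector.span (range (weyl_elem :: complex \<Rightarrow> _)))"
      by (simp add: ccr_generated)
    show "continuous_on UNIV (\<lambda>b. \<omega> (weyl_elem x * (ccr_embed e k b * ?P)))"
      by (intro cont continuous_intros ccr_embed(2)[OF onb]) (auto intro: B0_closed x P ccr_embed_in_B0)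
    show "continuous_on UNIV (\<lambda>b. \<omega> (weyl_elem x) * \<omega> (ccr_embed e 0 b) * ?p)"
      by (intro continuous_intros cont ccr_embed(2)[OF onb]) (auto intro: ccr_embed_in_B0)
    fix b :: "complex ccr" assume "b \<in> range weyl_elem"
    then obtain z where b: "b = weyl_elem z" by blast
    \<comment> \<open>The Weyl element of the factor at \<open>k\<close> merges with the one in
      front. Distinctness of the indices keeps \<open>?y\<close> orthogonal to the remaining basis
      vectors, as the induction hypothesis requires.\<close>
    let ?y = "x + z *\<^sub>C e k"
    have "cinner x (e k) = 0" using Cons.prems(3) by simp
    then have "weyl_elem x * (ccr_embed e k b * ?P) = weyl_elem ?y * ?P"
      by (simp add: b ccr_embed(3)[OF onb] weyl_elem_mult_orthogonal cinner_scaleC_right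
          flip: mult.assoc)
    moreover have "cinner ?y (e j) = 0" if "j \<in> set ks" for j
      using that Cons.prems by (auto simp: cinner_add_left cinner_scaleC_left ip)
    then have "\<omega> (weyl_elem ?y * ?P) = \<omega> (weyl_elem ?y) * ?p"
      using Cons.prems by (intro Cons.IH) (auto intro: span_intros)
    moreover have "\<omega> (weyl_elem ?y) = \<omega> (weyl_elem x) * \<omega> (weyl_elem (z *\<^sub>C e 0))"
      using Cons.prems by (intro extreme_imp_weyl_factor ext) auto
    ultimately show "\<omega> (weyl_elem x * (ccr_embed e k b * ?P)) = \<omega> (weyl_elem x) * \<omega> (ccr_embed e 0 b) * ?p"
      by (simp add: b ccr_embed(3)[OF onb])
  qed (simp_all add: hom ring_distribs state_simps B0_closed x P ccr_embed_in_B0)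
  then show ?case by (simp add: mult.assoc)
qed simp

end

theorem proposition3p4:
  fixes e :: "int \<Rightarrow> 'h::complex_hilbert" and \<omega> :: "'h ccr \<Rightarrow> complex"
  assumes "orthonormal_basis e"
    and "extreme_functional \<omega> (rotatable_states e)"
  shows "\<exists>\<phi> :: complex ccr \<Rightarrow> complex. \<phi> \<in> states_on UNIV \<and> is_product_state e \<phi> \<omega>"
proof -
  interpret rotatable e \<omega>
    using assms by unfold_locales (auto simp: extreme_functional_def)
  \<comment> \<open>The instance \<open>x = 0\<close>, where the Weyl element in front is the
    unit.\<close>
  have "\<omega> (\<Prod>k\<leftarrow>ks. ccr_embed e k (a k)) = (\<Prod>k\<leftarrow>ks. \<omega> (ccr_embed e 0 (a k)))"
    if "distinct ks" for ks and a :: "int \<Rightarrow> complex ccr"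
    using extreme_imp_product[OF assms(2) that complex_vector.span_zero, of a]
    by (simp add: weyl_elem_0 state_simps)
  then have "is_product_state e (\<omega> \<circ> ccr_embed e 0) \<omega>"
    by (simp add: is_product_state_def state)
  then show ?thesis using marginal_state by blast
qed

end
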